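(* There is a superalgebra isomorphism $\mathcal S(m|n,r)\cong\mathrm{End}_{\mathcal H}(V(m|n)^{\otimes r})$.
   Context: Let $m,n\ge0$ be integers, not both zero, $r\ge1$, $\mathcal Z=\mathbb Z[\boldsymbol\upsilon,\boldsymbol\upsilon^{-1}]$, $v=\boldsymbol\upsilon$, $\boldsymbol q=\boldsymbol\upsilon^2$. $\mathcal H$ is the Hecke algebra of $\mathfrak S_r$ over $\mathcal Z$ (length $l$, simple reflections $s_i=(i,i+1)$): basis $T_w$, $T_{s}^2=(\boldsymbol q-1)T_{s}+\boldsymbol q$, $T_yT_w=T_{yw}$ if $l(yw)=l(y)+l(w)$; $\mathcal T_i=\boldsymbol\upsilon^{-1}T_{s_i}$. $\Lambda(m|n,r)$: pairs $\lambda|\mu$, $\lambda\in\mathbb N^m,\mu\in\mathbb N^n$, $|\lambda|+|\mu|=r$. For a composition $\nu$ of $r$, $\mathfrak S_\nu$ is the standard Young subgroup. $\lambda^*=(\lambda_1,\dots,\lambda_m,1^{r-|\lambda|})$, ${}^*\mu=(1^{r-|\mu|},\mu_1,\dots,\mu_n)$, $x_\lambda=\sum_{w\in\mathfrak S_{\lambda^*}}T_w$, $y_\mu=\sum_{w\in\mathfrak S_{{}^*\mu}}(-\boldsymbol q)^{-l(w)}T_w$. The quantum Schur superalgebra is $\mathcal S(m|n,r)=\mathrm{End}_{\mathcal H}(\bigoplus_{\lambda|\mu\in\Lambda(m|n,r)}x_\lambda y_\mu\mathcal H)$, $\mathbb Z_2$-graded so that $\mathrm{Hom}_{\mathcal H}(x_\xi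 y_\eta\mathcal H,x_\lambda y_\mu\mathcal H)$ has degree $|\mu|+|\eta|$ mod 2, with supermultiplication $\phi\psi=(-1)^{\hat\phi\hat\psi}\phi\circ\psi$ for homogeneous elements of degrees $\hat\phi,\hat\psi$. $\hat i=0$ for $i\le m$, $\hat i=1$ for $m<i\le m+n$. $V(m|n)$ is the free $\mathcal Z$-module with basis $e_1,\dots,e_{m+n}$, $e_i$ of degree $\hat i\in\mathbb Z_2$; $V(m|n)^{\otimes r}$ and its endomorphism algebra carry the induced $\mathbb Z_2$-gradings. $\mathcal H$ acts on the right on $V(m|n)^{\otimes r}$, $\mathcal T_i$ acting as $\check{\mathcal R}$ on the tensor factors $i,i+1$, where $$(e_c\otimes e_d)\check{\mathcal R}=\begin{cases}v\,e_c\otimes e_c,&c=d\le m,\\-v^{-1}e_c\otimes e_c,&m+1\le c=d,\\(-1)^{\hat c\hat d}e_d\otimes e_c+(v-v^{-1})e_c\otimes e_d,&c>d,\\(-1)^{\hat c\hat d}e_d\otimes e_c,&c<d.\end{cases}$$ *)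

theory Defs
  imports
    Complex_Main
    "HOL-Library.Poly_Mapping"
    "HOL-Library.Function_Algebras"
    "HOL-Library.FuncSet"
    "HOL-Library.Z2"
    "HOL-Combinatorics.Permutations"
    "HOL-Algebra.Module"
    "HOL-Algebra.QuotRing"
begin

section \<open>The ground ring\<close>

text \<open>The group ring of the integers is the ring of integral Laurent polynomials;
  \<open>Poly_Mapping.single k 1\<close> is the \<open>k\<close>-th power of the indeterminate.\<close>

type_synonym laurent = "int \<Rightarrow>\<^sub>0 int"

definition vv :: laurent where "vv = Poly_Mapping.single 1 1"

definition vinv :: laurent where "vinv = Poly_Mapping.single (-1) 1"

definition qq :: laurent where "qq = vv ^ 2"

definition qinv :: laurent where "qinv = vinv ^ 2"

section \<open>The symmetric group on \<open>{1..r}\<close>\<close>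

definition symgrp :: "nat \<Rightarrow> (nat \<Rightarrow> nat) set" where
  "symgrp r = {w. w permutes {1..r}}"

definition simple_refl :: "nat \<Rightarrow> nat \<Rightarrow> nat" where
  "simple_refl i = transpose i (Suc i)"

definition word_perm :: "nat list \<Rightarrow> nat \<Rightarrow> nat" where
  "word_perm is = foldr (\<lambda>i w. simple_refl i \<circ> w) is id"

definition len :: "nat \<Rightarrow> (nat \<Rightarrow> nat) \<Rightarrow> nat" where
  "len r w = (LEAST k. \<exists>is. set is \<subseteq> {1..<r} \<and> word_perm is = w \<and> length is = k)"

definition reduced_word :: "nat \<Rightarrow> (nat \<Rightarrow> nat) \<Rightarrow> nat list" where
  "reduced_word r w =
     (SOME is. set is \<subseteq> {1..<r} \<and> word_perm is = w \<and> length is = len r w)"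

text \<open>A composition is a list of natural numbers (zero parts allowed); its blocks are
  counted from 0.\<close>

definition block :: "nat list \<Rightarrow> nat \<Rightarrow> nat set" where
  "block \<nu> k = {sum_list (take k \<nu>) <.. sum_list (take (Suc k) \<nu>)}"

definition young :: "nat \<Rightarrow> nat list \<Rightarrow> (nat \<Rightarrow> nat) set" where
  "young r \<nu> = {w \<in> symgrp r. \<forall>k < length \<nu>. w ` block \<nu> k = block \<nu> k}"

section \<open>The Hecke algebra\<close>

text \<open>The Hecke algebra is the type \<open>'h\<close>, an associative unital algebra over the
  Laurent polynomials with scalar multiplication \<open>scale\<close> and free basis \<open>T w\<close>.\<close>

locale hecke_algebra = Modules.module scale
  for scale :: "laurent \<Rightarrow> 'h::ring_1 \<Rightarrow> 'h"
  and r :: nat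
  and T :: "(nat \<Rightarrow> nat) \<Rightarrow> 'h" +
  assumes scale_mult_left: "scale c (x * y) = scale c x * y"
    and scale_mult_right: "scale c (x * y) = x * scale c y"
    and T_inj: "inj_on T (symgrp r)"
    and T_indep: "independent (T ` symgrp r)"
    and T_span: "span (T ` symgrp r) = UNIV"
    and T_quadratic: "i \<in> {1..<r} \<Longrightarrow>
      T (simple_refl i) * T (simple_refl i) = scale (qq - 1) (T (simple_refl i)) + scale qq 1"
    and T_mult: "u \<in> symgrp r \<Longrightarrow> w \<in> symgrp r \<Longrightarrow> len r (u \<circ> w) = len r u + len r w \<Longrightarrow>
      T u * T w = T (u \<circ> w)"

section \<open>Superalgebras\<close>

text \<open>The field \<open>homog a\<close> is the homogeneous component of degree \<open>a\<close>.\<close>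

record ('a, 'b) superalgebra = "('a, 'b) module" +
  homog :: "bit \<Rightarrow> 'b set"

definition superalgebra_iso ::
    "(laurent, 'a) superalgebra \<Rightarrow> (laurent, 'b) superalgebra \<Rightarrow> ('a \<Rightarrow> 'b) set" where
  "superalgebra_iso A B = {h \<in> ring_iso A B.
     (\<forall>c. \<forall>x \<in> carrier A. h (c \<odot>\<^bsub>A\<^esub> x) = c \<odot>\<^bsub>B\<^esub> h x) \<and>
     (\<forall>a. h ` homog A a = homog B a)}"

definition is_superalgebra_iso ::
    "(laurent, 'a) superalgebra \<Rightarrow> (laurent, 'b) superalgebra \<Rightarrow> bool" (infix "\<cong>\<^sub>s" 60) where
  "A \<cong>\<^sub>s B \<longleftrightarrow> superalgebra_iso A B \<noteq> {}"

section \<open>Graded endomorphism algebras\<close>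

text \<open>The modules considered below are direct sums over a finite index set, each index
  carrying a parity. Elements are functions on the index type vanishing off the index set;
  \<open>gproj par b\<close> projects onto the part of degree \<open>b\<close>. A right action of the Hecke algebra
  is a function \<open>act\<close>; an endomorphism is an additive map commuting with it (linearity
  over the Laurent polynomials is then automatic, as they act through the Hecke algebra),
  made extensional outside \<open>M\<close>. It has degree \<open>a\<close> iff
  its component from the summand \<open>j\<close> to the summand \<open>i\<close> vanishes unless
  \<open>par i + par j = a\<close>.\<close>

definition gproj :: "('i \<Rightarrow> bit) \<Rightarrow> bit \<Rightarrow> ('i \<Rightarrow> 'b::zero) \<Rightarrow> 'i \<Rightarrow> 'b" where
  "gproj par b f = (\<lambda>i. if par i = b then f i else 0)"

definition gpart :: "('i \<Rightarrow> 'b::zero) set \<Rightarrow> ('i \<Rightarrow> bit) \<Rightarrow> bit \<Rightarrow> ('i \<Rightarrow> 'b) set" where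
  "gpart M par b = {f \<in> M. gproj par b f = f}"

definition endos ::
    "('i \<Rightarrow> 'b::ab_group_add) set \<Rightarrow> (('i \<Rightarrow> 'b) \<Rightarrow> 'h \<Rightarrow> 'i \<Rightarrow> 'b) \<Rightarrow>
     (('i \<Rightarrow> 'b) \<Rightarrow> 'i \<Rightarrow> 'b) set" where
  "endos M act = {\<phi> \<in> M \<rightarrow>\<^sub>E M.
     (\<forall>f \<in> M. \<forall>g \<in> M. \<phi> (f + g) = \<phi> f + \<phi> g) \<and>
     (\<forall>f \<in> M. \<forall>h. \<phi> (act f h) = act (\<phi> f) h)}"

definition end_superalgebra ::
    "('i \<Rightarrow> 'b::ab_group_add) set \<Rightarrow> ('i \<Rightarrow> bit) \<Rightarrow> (laurent \<Rightarrow> 'b \<Rightarrow> 'b) \<Rightarrow>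
     (('i \<Rightarrow> 'b) \<Rightarrow> 'h \<Rightarrow> 'i \<Rightarrow> 'b) \<Rightarrow>
     (laurent, ('i \<Rightarrow> 'b) \<Rightarrow> 'i \<Rightarrow> 'b) superalgebra" where
  "end_superalgebra M par sm act =
    \<lparr>carrier = endos M act,
     mult = (\<lambda>\<phi> \<psi>. compose M \<phi> \<psi>),
     one = (\<lambda>f\<in>M. f),
     zero = (\<lambda>f\<in>M. 0),
     add = (\<lambda>\<phi> \<psi>. \<lambda>f\<in>M. \<phi> f + \<psi> f),
     smult = (\<lambda>c \<phi>. \<lambda>f\<in>M. \<lambda>i. sm c (\<phi> f i)),
     homog = (\<lambda>a. {\<phi> \<in> endos M act. \<forall>b. \<forall>f \<in> gpart M par b. \<phi> f \<in> gpart M par (a + b)})\<rparr>"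

definition bsign :: "bit \<Rightarrow> 'b \<Rightarrow> 'b::ab_group_add" where
  "bsign a x = (if a = 1 then - x else x)"

definition hcomp ::
    "('i \<Rightarrow> bit) \<Rightarrow> bit \<Rightarrow> (('i \<Rightarrow> 'b) \<Rightarrow> 'i \<Rightarrow> 'b) \<Rightarrow> ('i \<Rightarrow> 'b::ab_group_add) \<Rightarrow> 'i \<Rightarrow> 'b" where
  "hcomp par a \<phi> f = (\<Sum>b\<in>{0,1}. gproj par (a + b) (\<phi> (gproj par b f)))"

text \<open>The supermultiplication multiplies homogeneous elements of degrees \<open>a\<close>, \<open>b\<close> by
  composing them and inserting the sign \<open>(-1)^(a b)\<close>, and is extended biadditively through
  the homogeneous components \<open>hcomp\<close>.\<close>

definition supermult ::
    "('i \<Rightarrow> 'b::ab_group_add) set \<Rightarrow> ('i \<Rightarrow> bit) \<Rightarrow>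
     (('i \<Rightarrow> 'b) \<Rightarrow> 'i \<Rightarrow> 'b) \<Rightarrow> (('i \<Rightarrow> 'b) \<Rightarrow> 'i \<Rightarrow> 'b) \<Rightarrow> ('i \<Rightarrow> 'b) \<Rightarrow> 'i \<Rightarrow> 'b" where
  "supermult M par \<phi> \<psi> =
     (\<lambda>f\<in>M. \<Sum>a\<in>{0,1}. \<Sum>b\<in>{0,1}. bsign (a * b) (hcomp par a \<phi> (hcomp par b \<psi> f)))"

section \<open>The quantum Schur superalgebra\<close>

definition Lam :: "nat \<Rightarrow> nat \<Rightarrow> nat \<Rightarrow> (nat list \<times> nat list) set" where
  "Lam m n r =
     {(lam, mu) | lam mu. length lam = m \<and> length mu = n \<and> sum_list lam + sum_list mu = r}"

definition upper_star :: "nat \<Rightarrow> nat list \<Rightarrow> nat list" where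
  "upper_star r lam = lam @ replicate (r - sum_list lam) 1"

definition lower_star :: "nat \<Rightarrow> nat list \<Rightarrow> nat list" where
  "lower_star r mu = replicate (r - sum_list mu) 1 @ mu"

definition x_elt :: "nat \<Rightarrow> ((nat \<Rightarrow> nat) \<Rightarrow> 'h::ring_1) \<Rightarrow> nat list \<Rightarrow> 'h" where
  "x_elt r T lam = (\<Sum>w\<in>young r (upper_star r lam). T w)"

definition y_elt ::
    "(laurent \<Rightarrow> 'h \<Rightarrow> 'h) \<Rightarrow> nat \<Rightarrow> ((nat \<Rightarrow> nat) \<Rightarrow> 'h::ring_1) \<Rightarrow> nat list \<Rightarrow> 'h" where
  "y_elt scale r T mu = (\<Sum>w\<in>young r (lower_star r mu). scale ((- qinv) ^ len r w) (T w))"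

definition xyH ::
    "(laurent \<Rightarrow> 'h \<Rightarrow> 'h) \<Rightarrow> nat \<Rightarrow> ((nat \<Rightarrow> nat) \<Rightarrow> 'h::ring_1) \<Rightarrow> nat list \<times> nat list \<Rightarrow> 'h set"
  where "xyH scale r T p = {x_elt r T (fst p) * y_elt scale r T (snd p) * h | h. True}"

definition schur_module ::
    "nat \<Rightarrow> nat \<Rightarrow> (laurent \<Rightarrow> 'h \<Rightarrow> 'h) \<Rightarrow> nat \<Rightarrow> ((nat \<Rightarrow> nat) \<Rightarrow> 'h::ring_1) \<Rightarrow>
     (nat list \<times> nat list \<Rightarrow> 'h) set" where
  "schur_module m n scale r T =
     {f. (\<forall>p \<in> Lam m n r. f p \<in> xyH scale r T p) \<and> (\<forall>p. p \<notin> Lam m n r \<longrightarrow> f p = 0)}"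

definition schur_par :: "nat list \<times> nat list \<Rightarrow> bit" where
  "schur_par p = of_nat (sum_list (snd p))"

definition schur_superalgebra ::
    "nat \<Rightarrow> nat \<Rightarrow> (laurent \<Rightarrow> 'h \<Rightarrow> 'h) \<Rightarrow> nat \<Rightarrow> ((nat \<Rightarrow> nat) \<Rightarrow> 'h::ring_1) \<Rightarrow>
     (laurent, (nat list \<times> nat list \<Rightarrow> 'h) \<Rightarrow> nat list \<times> nat list \<Rightarrow> 'h) superalgebra" where
  "schur_superalgebra m n scale r T =
     (end_superalgebra (schur_module m n scale r T) schur_par scale (\<lambda>f h p. f p * h))
       \<lparr>mult := supermult (schur_module m n scale r T) schur_par\<rparr>"

section \<open>Tensor superspace\<close>

text \<open>The \<open>r\<close>-fold tensor power of the free module on \<open>e\<^sub>1, \<dots>, e\<^sub>m\<^sub>+\<^sub>n\<close> is the free module on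
  the multi-indices \<open>w : {1..r} \<rightarrow> {1..m+n}\<close>; \<open>ebasis w\<close> stands for the tensor product of
  the \<open>e\<close>'s with subscripts \<open>w 1, \<dots>, w r\<close>.\<close>

definition words :: "nat \<Rightarrow> nat \<Rightarrow> nat \<Rightarrow> (nat \<Rightarrow> nat) set" where
  "words m n r = {1..r} \<rightarrow>\<^sub>E {1..m + n}"

definition tensor_space :: "nat \<Rightarrow> nat \<Rightarrow> nat \<Rightarrow> ((nat \<Rightarrow> nat) \<Rightarrow> laurent) set" where
  "tensor_space m n r = {f. \<forall>w. w \<notin> words m n r \<longrightarrow> f w = 0}"

definition ebasis :: "(nat \<Rightarrow> nat) \<Rightarrow> (nat \<Rightarrow> nat) \<Rightarrow> laurent" where
  "ebasis w = (\<lambda>u. if u = w then 1 else 0)"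

definition lscale :: "laurent \<Rightarrow> ('i \<Rightarrow> laurent) \<Rightarrow> 'i \<Rightarrow> laurent" where
  "lscale c f = (\<lambda>u. c * f u)"

definition hat :: "nat \<Rightarrow> nat \<Rightarrow> bit" where
  "hat m i = (if i \<le> m then 0 else 1)"

definition tensor_par :: "nat \<Rightarrow> nat \<Rightarrow> (nat \<Rightarrow> nat) \<Rightarrow> bit" where
  "tensor_par m r w = (\<Sum>k\<in>{1..r}. hat m (w k))"

text \<open>The operator \<open>R\<close> on the tensor factors \<open>i, i+1\<close>, first on a basis vector and then
  extended linearly. Precomposing \<open>w\<close> with a simple reflection swaps these two factors.\<close>

definition R_basis :: "nat \<Rightarrow> nat \<Rightarrow> (nat \<Rightarrow> nat) \<Rightarrow> (nat \<Rightarrow> nat) \<Rightarrow> laurent" where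
  "R_basis m i w =
    (let c = w i; d = w (Suc i);
         swapped = bsign (hat m c * hat m d) (ebasis (w \<circ> simple_refl i))
     in if c = d \<and> c \<le> m then lscale vv (ebasis w)
        else if c = d then lscale (- vinv) (ebasis w)
        else if c > d then swapped + lscale (vv - vinv) (ebasis w)
        else swapped)"

definition R_op ::
    "nat \<Rightarrow> nat \<Rightarrow> nat \<Rightarrow> nat \<Rightarrow> ((nat \<Rightarrow> nat) \<Rightarrow> laurent) \<Rightarrow> (nat \<Rightarrow> nat) \<Rightarrow> laurent" where
  "R_op m n r i f = (\<Sum>w\<in>words m n r. lscale (f w) (R_basis m i w))"

text \<open>As \<open>v\<^sup>-\<^sup>1 T\<close> at the \<open>i\<close>-th simple reflection acts as \<open>R\<close> on the factors \<open>i, i+1\<close>, the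
  element \<open>T w\<close> acts as the composite of these operators along a reduced word of \<open>w\<close> (leftmost
  letter first, this being a right action) times the \<open>l(w)\<close>-th power of \<open>v\<close>.\<close>

definition act_T ::
    "nat \<Rightarrow> nat \<Rightarrow> nat \<Rightarrow> ((nat \<Rightarrow> nat) \<Rightarrow> laurent) \<Rightarrow> (nat \<Rightarrow> nat) \<Rightarrow> (nat \<Rightarrow> nat) \<Rightarrow> laurent" where
  "act_T m n r f w =
     lscale (vv ^ len r w) (foldl (\<lambda>g i. R_op m n r i g) f (reduced_word r w))"

definition tensor_act ::
    "nat \<Rightarrow> nat \<Rightarrow> (laurent \<Rightarrow> 'h \<Rightarrow> 'h) \<Rightarrow> nat \<Rightarrow> ((nat \<Rightarrow> nat) \<Rightarrow> 'h::ring_1) \<Rightarrow>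
     ((nat \<Rightarrow> nat) \<Rightarrow> laurent) \<Rightarrow> 'h \<Rightarrow> (nat \<Rightarrow> nat) \<Rightarrow> laurent" where
  "tensor_act m n scale r T f h =
     (\<Sum>w\<in>symgrp r.
        lscale (Modules.module.representation scale (T ` symgrp r) h (T w)) (act_T m n r f w))"

definition tensor_end_superalgebra ::
    "nat \<Rightarrow> nat \<Rightarrow> (laurent \<Rightarrow> 'h \<Rightarrow> 'h) \<Rightarrow> nat \<Rightarrow> ((nat \<Rightarrow> nat) \<Rightarrow> 'h::ring_1) \<Rightarrow>
     (laurent, ((nat \<Rightarrow> nat) \<Rightarrow> laurent) \<Rightarrow> (nat \<Rightarrow> nat) \<Rightarrow> laurent) superalgebra" where
  "tensor_end_superalgebra m n scale r T =
     end_superalgebra (tensor_space m n r) (tensor_par m r) (*) (tensor_act m n scale r T)"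

end

theory Submission
  imports Defs
begin

text \<open>
  Each summand \<open>x\<^sub>\<lambda> y\<^sub>\<mu> \<H>\<close> is identified with the weight space of the tensor power spanned by the
  \<open>e\<^sub>w\<close> whose subscripts have content \<open>\<lambda>|\<mu>\<close>. If \<open>w\<^sub>0\<close> is the weakly increasing word of that content, send
  \<open>e\<^sub>w\<close> to the sum of \<open>c(u) T u\<close> over all \<open>u\<close> with \<open>w\<^sub>0 \<circ> u = w\<close>, where \<open>c(u)\<close> is a product of one unit
  for each inversion of \<open>u\<close>. Comparing coefficients on the pairs \<open>{u, u s\<^sub>i}\<close> shows that this
  intertwines \<open>v R\<close> on the factors \<open>i, i+1\<close> with right multiplication by \<open>T s\<^sub>i\<close>. As it sends the
  generator \<open>e\<close> at \<open>w\<^sub>0\<close> to \<open>x\<^sub>\<lambda> y\<^sub>\<mu>\<close>, its image is \<open>x\<^sub>\<lambda> y\<^sub>\<mu> \<H>\<close>, and it is injective because the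
  supports for different \<open>w\<close> are disjoint and the \<open>c(u)\<close> are nonzero. Braid relations for \<open>R\<close> are
  not needed, since the action of \<open>\<H>\<close> is transported along words.

  This makes the two endomorphism algebras isomorphic with respect to composition. The sign in the
  supermultiplication is removed by multiplying the component of an endomorphism from degree \<open>b\<close> to
  degree \<open>c\<close> by \<open>(-1)\<close> to the power \<open>b(b+c)\<close>, which involves no square root of \<open>-1\<close>.
\<close>

section \<open>The sign twist\<close>

lemma gproj_plus: "gproj par b (f + g) = gproj par b f + gproj par b (g :: 'i \<Rightarrow> 'b::ab_group_add)"
  by (auto simp: gproj_def fun_eq_iff)

lemma gproj_minus: "gproj par b (f - g) = gproj par b f - gproj par b (g :: 'i \<Rightarrow> 'b::ab_group_add)"
  by (auto simp: gproj_def fun_eq_iff)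

lemma gproj_uminus: "gproj par b (- g) = - gproj par b (g :: 'i \<Rightarrow> 'b::ab_group_add)"
  by (auto simp: gproj_def fun_eq_iff)

lemma gproj_gproj: "gproj par b (gproj par c f) = (if b = c then gproj par b f else 0)"
  by (auto simp: gproj_def fun_eq_iff)

lemma gproj_zero [simp]: "gproj par b (0 :: 'i \<Rightarrow> 'b::ab_group_add) = 0"
  by (auto simp: gproj_def fun_eq_iff)

lemma gproj_sum: "gproj par 0 f + gproj par 1 f = (f :: 'i \<Rightarrow> 'b::ab_group_add)"
  by (auto simp: gproj_def fun_eq_iff)

text \<open>The grading involution. Composed after a map, it negates exactly the components that
  land in odd degree, so the sign twist can be written without naming the four components of an
  endomorphism.\<close>

definition parity_op :: "('i \<Rightarrow> bit) \<Rightarrow> ('i \<Rightarrow> 'b::ab_group_add) \<Rightarrow> 'i \<Rightarrow> 'b" where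
  "parity_op par f = (\<lambda>i. bsign (par i) (f i))"

lemma parity_op_eq: "parity_op par f = gproj par 0 f - gproj par 1 f"
  by (auto simp: parity_op_def gproj_def bsign_def fun_eq_iff)

lemma parity_op_parity_op [simp]: "parity_op par (parity_op par f) = f"
  by (auto simp: parity_op_def bsign_def fun_eq_iff)

lemma parity_op_plus: "parity_op par (f + g) = parity_op par f + parity_op par g"
  by (auto simp: parity_op_def bsign_def fun_eq_iff)

lemma parity_op_uminus: "parity_op par (- f) = - parity_op par f"
  by (auto simp: parity_op_def bsign_def fun_eq_iff)

text \<open>Both the direct sum of the modules \<open>xyH\<close> and the tensor space are
  instances, so the sign twist and the transport of endomorphism algebras are proved only
  once.\<close>

locale graded_module =
  fixes M :: "('i \<Rightarrow> 'b::ab_group_add) set" and par :: "'i \<Rightarrow> bit"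
    and sm :: "laurent \<Rightarrow> 'b \<Rightarrow> 'b"
    and act :: "('i \<Rightarrow> 'b) \<Rightarrow> 'h \<Rightarrow> 'i \<Rightarrow> 'b"
  assumes zero_mem: "0 \<in> M"
    and diff_mem: "f \<in> M \<Longrightarrow> g \<in> M \<Longrightarrow> f - g \<in> M"
    and gproj_mem: "f \<in> M \<Longrightarrow> gproj par b f \<in> M"
    and act_mem: "f \<in> M \<Longrightarrow> act f h \<in> M"
    and act_add: "f \<in> M \<Longrightarrow> g \<in> M \<Longrightarrow> act (f + g) h = act f h + act g h"
    and act_gproj: "f \<in> M \<Longrightarrow> act (gproj par b f) h = gproj par b (act f h)"
    and sm_add: "sm c (x + y) = sm c x + sm c y"
begin

lemma uminus_mem: "f \<in> M \<Longrightarrow> - f \<in> M"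
  using diff_mem[OF zero_mem, of f] by simp

lemma add_mem: "f \<in> M \<Longrightarrow> g \<in> M \<Longrightarrow> f + g \<in> M"
  using diff_mem[OF _ uminus_mem, of f g] by simp

lemma parity_op_mem: "f \<in> M \<Longrightarrow> parity_op par f \<in> M"
  by (simp add: parity_op_eq diff_mem gproj_mem)

lemma act_uminus: "f \<in> M \<Longrightarrow> act (- f) h = - act f h"
  using act_add[OF uminus_mem, of f f h] act_add[OF zero_mem zero_mem, of h]
  by (simp add: eq_neg_iff_add_eq_0)

lemma act_diff: "f \<in> M \<Longrightarrow> g \<in> M \<Longrightarrow> act (f - g) h = act f h - act g h"
  using act_add[OF _ uminus_mem, of f g h] by (simp add: act_uminus)

lemma act_parity_op: "f \<in> M \<Longrightarrow> act (parity_op par f) h = parity_op par (act f h)"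
  by (simp add: parity_op_eq act_diff act_gproj gproj_mem)

lemma sm_zero: "sm c 0 = 0"
  using sm_add[of c 0 0] by simp

lemma sm_uminus: "sm c (- x) = - sm c x"
  using sm_add[of c x "- x"] by (simp add: sm_zero eq_neg_iff_add_eq_0 add.commute)

lemma endos_mem: "\<phi> \<in> endos M act \<Longrightarrow> f \<in> M \<Longrightarrow> \<phi> f \<in> M"
  by (auto simp: endos_def)

lemma endos_add: "\<phi> \<in> endos M act \<Longrightarrow> f \<in> M \<Longrightarrow> g \<in> M \<Longrightarrow> \<phi> (f + g) = \<phi> f + \<phi> g"
  by (auto simp: endos_def)

lemma endos_act: "\<phi> \<in> endos M act \<Longrightarrow> f \<in> M \<Longrightarrow> \<phi> (act f h) = act (\<phi> f) h"
  by (auto simp: endos_def)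

lemma endos_zero: "\<phi> \<in> endos M act \<Longrightarrow> \<phi> 0 = 0"
  using endos_add[OF _ zero_mem zero_mem, of \<phi>] by simp

lemma endos_uminus: "\<phi> \<in> endos M act \<Longrightarrow> f \<in> M \<Longrightarrow> \<phi> (- f) = - \<phi> f"
  by (metis ab_left_minus endos_add endos_zero eq_neg_iff_add_eq_0 uminus_mem)

lemma endos_split:
  assumes "\<phi> \<in> endos M act" "f \<in> M"
  shows "\<phi> f = \<phi> (gproj par 0 f) + \<phi> (gproj par 1 f)"
proof -
  have "\<phi> f = \<phi> (gproj par 0 f + gproj par 1 f)" by (simp only: gproj_sum)
  also have "\<dots> = \<phi> (gproj par 0 f) + \<phi> (gproj par 1 f)"
    by (rule endos_add) (use assms gproj_mem in auto)
  finally show ?thesis .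
qed

text \<open>The signs are -1 exactly on the component from degree 1 to degree 0.\<close>

definition twist :: "(('i \<Rightarrow> 'b) \<Rightarrow> 'i \<Rightarrow> 'b) \<Rightarrow> ('i \<Rightarrow> 'b) \<Rightarrow> 'i \<Rightarrow> 'b" where
  "twist \<phi> = (\<lambda>f\<in>M. \<phi> (gproj par 0 f) - parity_op par (\<phi> (gproj par 1 f)))"

lemma twist_endos:
  assumes "\<phi> \<in> endos M act"
  shows "twist \<phi> \<in> endos M act"
proof -
  have "twist \<phi> f \<in> M" if "f \<in> M" for f
    using that assms
    by (simp add: twist_def diff_mem parity_op_mem endos_mem gproj_mem)
  moreover have "twist \<phi> (f + g) = twist \<phi> f + twist \<phi> g" if "f \<in> M" "g \<in> M" for f g
    using that assms
    by (simp add: twist_def add_mem gproj_plus endos_add[OF assms] gproj_mem parity_op_plus)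
  moreover have "twist \<phi> (act f h) = act (twist \<phi> f) h" if "f \<in> M" for f h
    using that assms
    by (simp add: twist_def act_mem flip: act_gproj)
       (simp add: endos_act gproj_mem act_diff parity_op_mem endos_mem act_parity_op)
  ultimately show ?thesis
    by (simp add: endos_def twist_def PiE_def)
qed

text \<open>Each of the four components is multiplied by a sign, and signs square to 1. This makes
  \<open>twist\<close> its own inverse in the bijectivity argument below.\<close>

lemma twist_twist:
  assumes "\<phi> \<in> endos M act"
  shows "twist (twist \<phi>) = \<phi>"
proof (rule extensionalityI[of _ M])
  show "\<phi> \<in> extensional M" using assms by (auto simp: endos_def PiE_def)
  show "twist (twist \<phi>) f = \<phi> f" if "f \<in> M" for f
    using endos_split[OF assms that] that
    by (simp add: twist_def gproj_mem gproj_gproj endos_zero[OF assms] parity_op_uminus)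
       (simp add: parity_op_eq)
qed (simp add: twist_def)

text \<open>A path of degrees b, c, d carries the sign (-1)^((b+c)(c+d)), which is negative only
  along 0, 1, 0 and 1, 0, 1. The first two terms collect the paths starting in degree 0, the last
  two those starting in degree 1.\<close>

lemma supermult_eq:
  assumes "\<phi> \<in> endos M act" "\<psi> \<in> endos M act" "f \<in> M"
  defines "g \<equiv> \<psi> (gproj par 0 f)" and "h \<equiv> \<psi> (gproj par 1 f)"
  shows "supermult M par \<phi> \<psi> f =
    \<phi> (gproj par 0 g) - parity_op par (\<phi> (gproj par 1 g)) +
    (\<phi> (gproj par 1 h) + parity_op par (\<phi> (gproj par 0 h)))"
proof -
  have mem: "g \<in> M" "h \<in> M"
    using assms by (auto simp: endos_mem gproj_mem)
  have A0: "hcomp par 0 \<psi> f = gproj par 0 g + gproj par 1 h"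
    by (simp add: hcomp_def g_def h_def)
  have A1: "hcomp par 1 \<psi> f = gproj par 1 g + gproj par 0 h"
    by (simp add: hcomp_def g_def h_def)
  note [simp] = endos_zero[OF assms(1)]
  show ?thesis
  proof
    fix i
    show "supermult M par \<phi> \<psi> f i =
      (\<phi> (gproj par 0 g) - parity_op par (\<phi> (gproj par 1 g)) +
      (\<phi> (gproj par 1 h) + parity_op par (\<phi> (gproj par 0 h)))) i"
      using assms(3)
      \<comment> \<open>The parity of the coordinate \<open>i\<close> is the final degree of the
        path, so here every term has a definite sign.\<close>
      by (cases "par i = 1")
        (simp_all add: supermult_def A0 A1, simp_all add: hcomp_def gproj_plus gproj_gproj,
          simp_all add: gproj_def bsign_def parity_op_def)
  qed
qed

lemma compose_endos:
  assumes "\<phi> \<in> endos M act" "\<psi> \<in> endos M act"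
  shows "compose M \<phi> \<psi> \<in> endos M act"
  using assms unfolding endos_def by (auto simp: compose_def add_mem act_mem PiE_def Pi_def)

text \<open>Modulo 2 one has b(b+c) + c(c+d) + b(b+d) = (b+c)(c+d). The left side is the total
  exponent from twisting the two factors and their composite along a path b, c, d; the right side is
  the exponent in the supermultiplication.\<close>

lemma supermult_eq_twist:
  assumes "\<phi> \<in> endos M act" "\<psi> \<in> endos M act"
  shows "supermult M par \<phi> \<psi> = twist (compose M (twist \<phi>) (twist \<psi>))"
proof (rule extensionalityI[of _ M])
  fix f assume f: "f \<in> M"
  define g where "g = \<psi> (gproj par 0 f)"
  define h where "h = \<psi> (gproj par 1 f)"
  have mem: "g \<in> M" "h \<in> M"
    using assms f by (auto simp: endos_mem gproj_mem g_def h_def)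
  have "gproj par 0 (parity_op par h) = gproj par 0 h"
    "gproj par 1 (parity_op par h) = - gproj par 1 h"
    by (auto simp: parity_op_eq gproj_minus gproj_gproj)
  then have *: "twist \<phi> (- parity_op par h) = - (\<phi> (gproj par 0 h) + parity_op par (\<phi> (gproj par 1 h)))"
    using mem
    by (simp add: endos_uminus[OF twist_endos[OF assms(1)]] parity_op_mem)
       (simp add: twist_def parity_op_mem endos_uminus[OF assms(1)] gproj_mem parity_op_uminus)
  \<comment> \<open>A homogeneous part of \<open>f\<close> is killed by the other projection, so
    only one term of \<open>twist\<close> survives on it.\<close>
  have "twist \<psi> (gproj par 0 f) = g" "twist \<psi> (gproj par 1 f) = - parity_op par h"
    using f by (simp_all add: twist_def gproj_mem gproj_gproj endos_zero[OF assms(2)] g_def h_def)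
      (simp_all add: parity_op_eq)
  then have "twist (compose M (twist \<phi>) (twist \<psi>)) f =
      twist \<phi> g - parity_op par (twist \<phi> (- parity_op par h))"
    using f by (subst twist_def) (simp add: compose_def gproj_mem)
  also have "\<dots> = supermult M par \<phi> \<psi> f"
    using mem by (simp add: * supermult_eq[OF assms f] parity_op_uminus parity_op_plus flip: g_def h_def)
      (simp add: twist_def flip: parity_op_uminus parity_op_plus, simp add: parity_op_uminus parity_op_plus)
  finally show "supermult M par \<phi> \<psi> f = twist (compose M (twist \<phi>) (twist \<psi>)) f" ..
qed (simp_all add: twist_def supermult_def)

lemma twist_supermult:
  assumes "\<phi> \<in> endos M act" "\<psi> \<in> endos M act"
  shows "twist (supermult M par \<phi> \<psi>) = compose M (twist \<phi>) (twist \<psi>)"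
  unfolding supermult_eq_twist[OF assms] by (intro twist_twist compose_endos twist_endos assms)

text \<open>On a homogeneous argument \<open>twist\<close> changes the value at most by the negated
  grading involution, which preserves degrees.\<close>

lemma twist_homog:
  assumes "\<phi> \<in> homog (end_superalgebra M par sm act) a"
  shows "twist \<phi> \<in> homog (end_superalgebra M par sm act) a"
proof -
  have \<phi>: "\<phi> \<in> endos M act" and *: "\<And>b f. f \<in> gpart M par b \<Longrightarrow> \<phi> f \<in> gpart M par (a + b)"
    using assms by (auto simp: end_superalgebra_def)
  have "twist \<phi> f \<in> gpart M par (a + b)" if "f \<in> gpart M par b" for f b
  proof -
    have f: "f \<in> M" "gproj par b f = f" using that by (auto simp: gpart_def)
    have g: "\<phi> f \<in> M" "gproj par (a + b) (\<phi> f) = \<phi> f" using *[OF that] by (auto simp: gpart_def)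
    have "gproj par c f = (if c = b then f else 0)" for c
      by (metis f(2) gproj_gproj)
    then have "twist \<phi> f = (if b = 0 then \<phi> f else - parity_op par (\<phi> f))"
      using f(1) by (cases "b = 0") (simp_all add: twist_def endos_zero[OF \<phi>] parity_op_eq)
    moreover have "gproj par (a + b) (parity_op par (\<phi> f)) = parity_op par (gproj par (a + b) (\<phi> f))"
      by (auto simp: gproj_def parity_op_def bsign_def fun_eq_iff)
    ultimately show ?thesis
      using g by (cases "b = 0") (simp_all only: gpart_def gproj_uminus parity_op_mem uminus_mem
          mem_Collect_eq if_True if_False simp_thms)
  qed
  then show ?thesis using twist_endos[OF \<phi>] by (simp add: end_superalgebra_def)
qed

lemma twist_superalgebra_iso:
  "twist \<in> superalgebra_iso
     ((end_superalgebra M par sm act)\<lparr>mult := supermult M par\<rparr>) (end_superalgebra M par sm act)"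
proof -
  let ?B = "end_superalgebra M par sm act" and ?A = "(end_superalgebra M par sm act)\<lparr>mult := supermult M par\<rparr>"
  have "twist \<in> ring_iso ?A ?B"
  proof (rule ring_iso_memI)
    show "twist \<phi> \<in> carrier ?B" if "\<phi> \<in> carrier ?A" for \<phi>
      using that by (simp add: end_superalgebra_def twist_endos)
    show "twist (\<phi> \<otimes>\<^bsub>?A\<^esub> \<psi>) = twist \<phi> \<otimes>\<^bsub>?B\<^esub> twist \<psi>"
      if "\<phi> \<in> carrier ?A" "\<psi> \<in> carrier ?A" for \<phi> \<psi>
      using that by (simp add: end_superalgebra_def twist_supermult)
    show "twist (\<phi> \<oplus>\<^bsub>?A\<^esub> \<psi>) = twist \<phi> \<oplus>\<^bsub>?B\<^esub> twist \<psi>"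
      if "\<phi> \<in> carrier ?A" "\<psi> \<in> carrier ?A" for \<phi> \<psi>
      by (rule ext) (simp add: end_superalgebra_def twist_def gproj_mem parity_op_plus restrict_def)
    show "twist \<one>\<^bsub>?A\<^esub> = \<one>\<^bsub>?B\<^esub>"
    proof -
      have "gproj par 0 f - parity_op par (gproj par 1 f) = f" for f :: "'i \<Rightarrow> 'b"
        by (auto simp: gproj_def parity_op_def bsign_def)
      then show ?thesis by (simp add: end_superalgebra_def twist_def gproj_mem restrict_def cong: if_cong)
    qed
    show "bij_betw twist (carrier ?A) (carrier ?B)"
      by (rule bij_betw_byWitness[where f' = twist])
        (auto simp: end_superalgebra_def twist_twist twist_endos)
  qed
  moreover have "twist (c \<odot>\<^bsub>?A\<^esub> \<phi>) = c \<odot>\<^bsub>?B\<^esub> twist \<phi>" for c \<phi>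
  proof -
    have "sm c (x - y) = sm c x - sm c y" for x y
      using sm_add[of c x "- y"] by (simp add: sm_uminus)
    then have "(\<lambda>i. sm c ((f - parity_op par g) i)) = (\<lambda>i. sm c (f i)) - parity_op par (\<lambda>i. sm c (g i))" for f g
      by (auto simp: parity_op_def bsign_def fun_eq_iff sm_uminus)
    then show ?thesis
      by (simp add: end_superalgebra_def twist_def gproj_mem restrict_def fun_eq_iff)
  qed
  moreover have "twist ` homog ?A a = homog ?B a" for a
  proof
    show "twist ` homog ?A a \<subseteq> homog ?B a"
      using twist_homog[of _ a] by (auto simp: end_superalgebra_def simp del: add_bit_eq_xor)
    \<comment> \<open>The two algebras have the same homogeneous parts, so the involution turns the
      preservation of degrees into surjectivity.\<close>
    show "homog ?B a \<subseteq> twist ` homog ?A a"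
    proof
      fix \<phi> assume \<phi>: "\<phi> \<in> homog ?B a"
      then have "twist (twist \<phi>) = \<phi>" by (intro twist_twist) (simp add: end_superalgebra_def)
      moreover have "twist \<phi> \<in> homog ?A a"
        using twist_homog[OF \<phi>] by (simp add: end_superalgebra_def del: add_bit_eq_xor)
      ultimately show "\<phi> \<in> twist ` homog ?A a" by (metis imageI)
    qed
  qed
  ultimately show ?thesis
    by (simp add: superalgebra_iso_def)
qed

end

section \<open>Transport of endomorphism algebras\<close>

lemma superalgebra_iso_trans: "A \<cong>\<^sub>s B \<Longrightarrow> B \<cong>\<^sub>s C \<Longrightarrow> A \<cong>\<^sub>s C"
proof -
  assume "A \<cong>\<^sub>s B" "B \<cong>\<^sub>s C"
  then obtain f g where fg: "f \<in> superalgebra_iso A B" "g \<in> superalgebra_iso B C"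
    by (auto simp: is_superalgebra_iso_def)
  then have "f x \<in> carrier B" if "x \<in> carrier A" for x
    using that by (auto simp: superalgebra_iso_def dest: ring_iso_memE(1))
  then have "g \<circ> f \<in> superalgebra_iso A C"
    using fg ring_iso_set_trans[of f A B g C]
    by (simp add: superalgebra_iso_def image_comp[symmetric, unfolded comp_def])
  then show ?thesis by (auto simp: is_superalgebra_iso_def)
qed

text \<open>The isomorphism is conjugation by \<Psi>. Since \<Psi> runs from \<open>N\<close> to
  \<open>M\<close>, an endomorphism \<phi> of \<open>M\<close> becomes
  \<open>\<Phi> \<circ> \<phi> \<circ> \<Psi>\<close>, restricted to \<open>N\<close> because
  endomorphisms are extensional functions.\<close>

lemma end_superalgebra_transport:
  fixes \<Psi> :: "('j \<Rightarrow> 'c::ab_group_add) \<Rightarrow> 'i \<Rightarrow> 'b::ab_group_add"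
  assumes M: "graded_module M par sm act" and N: "graded_module N par' sm' act'"
    and bij: "bij_betw \<Psi> N M"
    and add: "\<And>f g. f \<in> N \<Longrightarrow> g \<in> N \<Longrightarrow> \<Psi> (f + g) = \<Psi> f + \<Psi> g"
    and act: "\<And>f h. f \<in> N \<Longrightarrow> \<Psi> (act' f h) = act (\<Psi> f) h"
    and sm: "\<And>f c. f \<in> N \<Longrightarrow> (\<lambda>i. sm' c (f i)) \<in> N"
      "\<And>f c. f \<in> N \<Longrightarrow> \<Psi> (\<lambda>i. sm' c (f i)) = (\<lambda>i. sm c (\<Psi> f i))"
    and par: "\<And>f b. f \<in> N \<Longrightarrow> \<Psi> (gproj par' b f) = gproj par b (\<Psi> f)"
  shows "end_superalgebra M par sm act \<cong>\<^sub>s end_superalgebra N par' sm' act'"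
proof -
  interpret M: graded_module M par sm act by fact
  interpret N: graded_module N par' sm' act' by fact
  define \<Phi> where "\<Phi> = inv_into N \<Psi>"
  have \<Phi>N: "\<Phi> g \<in> N" and \<Psi>\<Phi>: "\<Psi> (\<Phi> g) = g" if "g \<in> M" for g
    using that bij unfolding \<Phi>_def bij_betw_def
    by (simp_all add: inv_into_into f_inv_into_f)
  have \<Psi>M: "\<Psi> f \<in> M" and \<Phi>\<Psi>: "\<Phi> (\<Psi> f) = f" if "f \<in> N" for f
    using that bij unfolding \<Phi>_def bij_betw_def by (auto simp: inv_into_f_f)
  have \<Phi>_add: "\<Phi> (f + g) = \<Phi> f + \<Phi> g" if "f \<in> M" "g \<in> M" for f g
    by (metis that \<Phi>N \<Psi>\<Phi> \<Phi>\<Psi> N.add_mem add)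
  have \<Phi>_act: "\<Phi> (act f h) = act' (\<Phi> f) h" if "f \<in> M" for f h
    by (metis that \<Phi>N \<Psi>\<Phi> \<Phi>\<Psi> N.act_mem act)
  have \<Phi>_sm: "\<Phi> (\<lambda>i. sm c (f i)) = (\<lambda>i. sm' c (\<Phi> f i))" if "f \<in> M" for f c
    using \<Phi>\<Psi>[OF sm(1)[OF \<Phi>N[OF that]], of c] sm(2)[OF \<Phi>N[OF that], of c]
    by (simp add: \<Psi>\<Phi>[OF that])
  have \<Phi>_gproj: "\<Phi> (gproj par b f) = gproj par' b (\<Phi> f)" if "f \<in> M" for f b
    by (metis that \<Phi>N \<Psi>\<Phi> \<Phi>\<Psi> N.gproj_mem par)
  have \<Psi>_gpart: "\<Psi> f \<in> gpart M par b" if "f \<in> gpart N par' b" for f b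
    using that by (simp add: gpart_def \<Psi>M flip: par)
  have \<Phi>_gpart: "\<Phi> f \<in> gpart N par' b" if "f \<in> gpart M par b" for f b
    using that by (simp add: gpart_def \<Phi>N flip: \<Phi>_gproj)
  let ?A = "end_superalgebra M par sm act" and ?B = "end_superalgebra N par' sm' act'"
  define F where "F = (\<lambda>\<phi>. \<lambda>f\<in>N. \<Phi> (\<phi> (\<Psi> f)))"
  define G where "G = (\<lambda>\<phi>. \<lambda>f\<in>M. \<Psi> (\<phi> (\<Phi> f)))"
  have F: "F \<phi> \<in> endos N act'" if "\<phi> \<in> endos M act" for \<phi>
    using that unfolding endos_def[of N]
    by (auto simp: F_def N.add_mem N.act_mem \<Psi>M \<Phi>N add act \<Phi>_add \<Phi>_act M.endos_mem
        M.endos_add[OF that] M.endos_act[OF that])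
  have G: "G \<phi> \<in> endos M act" if "\<phi> \<in> endos N act'" for \<phi>
    using that unfolding endos_def[of M]
    by (auto simp: G_def M.add_mem M.act_mem \<Psi>M \<Phi>N add act \<Phi>_add \<Phi>_act N.endos_mem
        N.endos_add[OF that] N.endos_act[OF that])
  have GF: "G (F \<phi>) = \<phi>" if "\<phi> \<in> endos M act" for \<phi>
    by (rule extensionalityI[of _ M])
       (use that in \<open>auto simp: G_def F_def \<Phi>N \<Psi>\<Phi> M.endos_mem\<close>, auto simp: endos_def PiE_def)
  have FG: "F (G \<phi>) = \<phi>" if "\<phi> \<in> endos N act'" for \<phi>
    by (rule extensionalityI[of _ N])
       (use that in \<open>auto simp: G_def F_def \<Psi>M \<Phi>\<Psi> N.endos_mem\<close>, auto simp: endos_def PiE_def)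
  have "F \<in> ring_iso ?A ?B"
  proof (rule ring_iso_memI)
    show "F \<phi> \<in> carrier ?B" if "\<phi> \<in> carrier ?A" for \<phi>
      using that by (simp add: end_superalgebra_def F)
    show "F (\<phi> \<otimes>\<^bsub>?A\<^esub> \<psi>) = F \<phi> \<otimes>\<^bsub>?B\<^esub> F \<psi>"
      if "\<phi> \<in> carrier ?A" "\<psi> \<in> carrier ?A" for \<phi> \<psi>
      using that
      by (auto simp: end_superalgebra_def F_def compose_def fun_eq_iff \<Psi>M \<Phi>N \<Psi>\<Phi> M.endos_mem)
    show "F (\<phi> \<oplus>\<^bsub>?A\<^esub> \<psi>) = F \<phi> \<oplus>\<^bsub>?B\<^esub> F \<psi>"
      if "\<phi> \<in> carrier ?A" "\<psi> \<in> carrier ?A" for \<phi> \<psi>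
      using that
      by (simp add: end_superalgebra_def F_def restrict_def fun_eq_iff \<Psi>M \<Phi>_add M.endos_mem)
    show "F \<one>\<^bsub>?A\<^esub> = \<one>\<^bsub>?B\<^esub>"
      by (auto simp: end_superalgebra_def F_def fun_eq_iff \<Psi>M \<Phi>\<Psi>)
    show "bij_betw F (carrier ?A) (carrier ?B)"
      by (rule bij_betw_byWitness[where f' = G])
        (auto simp: end_superalgebra_def F G FG GF)
  qed
  moreover have "F (c \<odot>\<^bsub>?A\<^esub> \<phi>) = c \<odot>\<^bsub>?B\<^esub> F \<phi>" if "\<phi> \<in> carrier ?A" for c \<phi>
    using that
    by (simp add: end_superalgebra_def F_def restrict_def fun_eq_iff \<Psi>M \<Phi>_sm M.endos_mem)
  moreover have "F ` homog ?A a = homog ?B a" for a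
  proof
    show "F ` homog ?A a \<subseteq> homog ?B a"
    proof
      fix \<theta> assume "\<theta> \<in> F ` homog ?A a"
      then obtain \<phi> where \<phi>: "\<theta> = F \<phi>" "\<phi> \<in> endos M act"
        "\<And>b f. f \<in> gpart M par b \<Longrightarrow> \<phi> f \<in> gpart M par (a + b)"
        by (auto simp: end_superalgebra_def simp del: add_bit_eq_xor)
      have "F \<phi> f \<in> gpart N par' (a + b)" if f: "f \<in> gpart N par' b" for f b
      proof -
        have "f \<in> N" using f by (simp add: gpart_def)
        then show ?thesis using \<Phi>_gpart[OF \<phi>(3)[OF \<Psi>_gpart[OF f]]] by (simp add: F_def)
      qed
      then show "\<theta> \<in> homog ?B a"
        by (simp add: end_superalgebra_def F \<phi>(1,2) del: add_bit_eq_xor)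
    qed
    \<comment> \<open>As \<open>F\<close> undoes \<open>G\<close>, the reverse inclusion follows
      once \<open>G\<close> is known to preserve degrees.\<close>
    have "G ` homog ?B a \<subseteq> homog ?A a"
    proof
      fix \<theta> assume "\<theta> \<in> G ` homog ?B a"
      then obtain \<phi> where \<phi>: "\<theta> = G \<phi>" "\<phi> \<in> endos N act'"
        "\<And>b f. f \<in> gpart N par' b \<Longrightarrow> \<phi> f \<in> gpart N par' (a + b)"
        by (auto simp: end_superalgebra_def simp del: add_bit_eq_xor)
      have "G \<phi> f \<in> gpart M par (a + b)" if f: "f \<in> gpart M par b" for f b
      proof -
        have "f \<in> M" using f by (simp add: gpart_def)
        then show ?thesis using \<Psi>_gpart[OF \<phi>(3)[OF \<Phi>_gpart[OF f]]] by (simp add: G_def)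
      qed
      then show "\<theta> \<in> homog ?A a"
        by (simp add: end_superalgebra_def G \<phi>(1,2) del: add_bit_eq_xor)
    qed
    moreover have "F (G \<phi>) = \<phi>" if "\<phi> \<in> homog ?B a" for \<phi>
      using that FG by (simp add: end_superalgebra_def)
    ultimately show "homog ?B a \<subseteq> F ` homog ?A a" by (force simp: image_iff)
  qed
  ultimately have "F \<in> superalgebra_iso ?A ?B"
    by (simp add: superalgebra_iso_def)
  then show ?thesis by (auto simp: is_superalgebra_iso_def)
qed

section \<open>Length and inversions\<close>

definition invs :: "nat \<Rightarrow> (nat \<Rightarrow> nat) \<Rightarrow> (nat \<times> nat) set" where
  "invs r u = {(i, j). i \<in> {1..r} \<and> j \<in> {1..r} \<and> i < j \<and> u j < u i}"

lemma finite_invs [simp]: "finite (invs r u)"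
  by (rule finite_subset[of _ "{1..r} \<times> {1..r}"]) (auto simp: invs_def)

lemma invs_id: "invs r id = {}" "invs r (\<lambda>x. x) = {}"
  by (auto simp: invs_def)

lemma finite_symgrp [simp]: "finite (symgrp r)"
  by (simp add: symgrp_def finite_permutations)

lemma symgrp_comp: "u \<in> symgrp r \<Longrightarrow> w \<in> symgrp r \<Longrightarrow> u \<circ> w \<in> symgrp r"
  by (simp add: symgrp_def permutes_compose)

lemma id_symgrp [simp]: "id \<in> symgrp r" "(\<lambda>x. x) \<in> symgrp r"
  by (simp_all add: symgrp_def permutes_id permutes_id[unfolded id_def])

lemma simple_refl_symgrp: "i \<in> {1..<r} \<Longrightarrow> simple_refl i \<in> symgrp r"
  by (simp add: symgrp_def simple_refl_def permutes_swap_id)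

lemma simple_refl_simple_refl [simp]: "simple_refl i (simple_refl i k) = k"
  by (simp add: simple_refl_def)

lemma simple_refl_apply [simp]: "simple_refl i i = Suc i" "simple_refl i (Suc i) = i"
  by (simp_all add: simple_refl_def)

lemma comp_simple_refl_cancel [simp]: "w \<circ> simple_refl i \<circ> simple_refl i = w"
  by (simp add: fun_eq_iff)

lemma simple_refl_mem_iff: "i \<in> {1..<r} \<Longrightarrow> simple_refl i k \<in> {1..r} \<longleftrightarrow> k \<in> {1..r}"
  using permutes_in_image[of "simple_refl i" "{1..r}" k] simple_refl_symgrp[of i r]
  by (simp add: symgrp_def)

lemma simple_refl_less:
  assumes "k < l" "(k, l) \<noteq> (i, Suc i)"
  shows "simple_refl i k < simple_refl i l"
  using assms by (auto simp: simple_refl_def transpose_def)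

lemma symgrp_inj: "u \<in> symgrp r \<Longrightarrow> u i = u j \<longleftrightarrow> i = j"
  unfolding symgrp_def by (metis mem_Collect_eq permutes_inj inj_eq)

lemma symgrp_mem: "u \<in> symgrp r \<Longrightarrow> u i \<in> {1..r} \<longleftrightarrow> i \<in> {1..r}"
  unfolding symgrp_def using permutes_in_image by fastforce

text \<open>A simple reflection preserves the order of every pair of positions except the one it
  exchanges. At an ascent the old inversions are therefore only renamed, and the exchanged pair is
  the single new one.\<close>

lemma invs_simple_refl:
  assumes i: "i \<in> {1..<r}" and less: "u i < u (Suc i)"
  defines "s \<equiv> simple_refl i"
  shows "invs r (u \<circ> s) = insert (i, Suc i) (map_prod s s ` invs r u)"
    and "(i, Suc i) \<notin> map_prod s s ` invs r u"
proof -
  have mem: "s k \<in> {1..r} \<longleftrightarrow> k \<in> {1..r}" for k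
    using simple_refl_mem_iff[OF i] by (simp add: s_def)
  have lt: "s k < s l" if "k < l" "(k, l) \<noteq> (i, Suc i)" for k l
    using simple_refl_less that by (simp add: s_def)
  show "invs r (u \<circ> s) = insert (i, Suc i) (map_prod s s ` invs r u)"
  proof (intro equalityI subsetI)
    fix x assume x: "x \<in> invs r (u \<circ> s)"
    show "x \<in> insert (i, Suc i) (map_prod s s ` invs r u)"
    proof (cases "x = (i, Suc i)")
      case False
      obtain k l where kl: "x = (k, l)" by (cases x)
      have "(s k, s l) \<in> invs r u"
        using x False lt[of k l] mem by (auto simp: invs_def kl)
      moreover have "x = map_prod s s (s k, s l)" by (simp add: kl s_def)
      ultimately show ?thesis by blast
    qed simp
  next
    fix x assume "x \<in> insert (i, Suc i) (map_prod s s ` invs r u)"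
    then consider "x = (i, Suc i)" | k l where "x = (s k, s l)" "(k, l) \<in> invs r u" by auto
    then show "x \<in> invs r (u \<circ> s)"
    proof cases
      case 1 then show ?thesis using i less by (simp add: invs_def s_def)
    next
      case 2
      then have "(k, l) \<noteq> (i, Suc i)" using less by (auto simp: invs_def)
      moreover have "s (s k) = k" "s (s l) = l" by (simp_all add: s_def)
      ultimately show ?thesis using lt[of k l] 2(2) unfolding 2(1) invs_def
        by (simp add: mem[unfolded One_nat_def] del: atLeastAtMost_iff)
    qed
  qed
  show "(i, Suc i) \<notin> map_prod s s ` invs r u"
  proof
    assume "(i, Suc i) \<in> map_prod s s ` invs r u"
    then obtain k l where "i = s k" "Suc i = s l" "(k, l) \<in> invs r u" by auto
    \<comment> \<open>The preimage of the new pair would be (i+1, i), whose entries are in the wrong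
      order for an inversion.\<close>
    moreover from this have "k = Suc i" "l = i" by (metis s_def simple_refl_apply simple_refl_simple_refl)+
    ultimately show False by (simp add: invs_def)
  qed
qed

lemma inj_map_prod_simple_refl: "inj_on (map_prod (simple_refl i) (simple_refl i)) A"
  by (rule inj_on_inverseI[of _ "map_prod (simple_refl i) (simple_refl i)"]) auto

lemma card_invs_simple_refl:
  assumes "i \<in> {1..<r}" "u i < u (Suc i)"
  shows "card (invs r (u \<circ> simple_refl i)) = Suc (card (invs r u))"
  using invs_simple_refl[where u = u, OF assms] by (simp add: card_image inj_map_prod_simple_refl)

lemma card_invs_simple_refl':
  assumes "i \<in> {1..<r}" "u (Suc i) < u i"
  shows "card (invs r u) = Suc (card (invs r (u \<circ> simple_refl i)))"
  using card_invs_simple_refl[where u = "u \<circ> simple_refl i", OF assms(1)] assms(2)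
  by simp

text \<open>Without descents \<open>u\<close> is increasing on {1..r}, so it moves no point down,
  and such a permutation is the identity.\<close>

lemma symgrp_no_descent:
  assumes u: "u \<in> symgrp r" and asc: "\<And>i. i \<in> {1..<r} \<Longrightarrow> u i < u (Suc i)"
  shows "u = id"
proof -
  have "k \<in> {1..r} \<longrightarrow> k \<le> u k" for k
  proof (induction k)
    case (Suc k)
    show ?case
    proof (cases "k = 0")
      case True
      then show ?thesis using symgrp_mem[OF u, of 1] by auto
    next
      case False
      then show ?thesis using Suc asc[of k] by auto
    qed
  qed simp
  then show ?thesis
    using permutes_natset_ge[of u "{1..r}"] u by (simp add: symgrp_def)
qed

section \<open>Words in the simple reflections and the length\<close>

lemma word_perm_append: "word_perm (is @ js) = word_perm is \<circ> word_perm js"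
  by (induction "is") (simp_all add: word_perm_def comp_assoc)

lemma word_perm_Nil [simp]: "word_perm [] = id"
  by (simp add: word_perm_def)

lemma word_perm_single [simp]: "word_perm [i] = simple_refl i"
  by (simp add: word_perm_def)

lemma word_perm_snoc: "word_perm (is @ [i]) = word_perm is \<circ> simple_refl i"
  unfolding word_perm_append word_perm_single ..

lemma word_perm_symgrp: "set is \<subseteq> {1..<r} \<Longrightarrow> word_perm is \<in> symgrp r"
  by (induction "is" rule: rev_induct)
     (simp_all add: word_perm_append symgrp_comp simple_refl_symgrp)

text \<open>Each letter changes the number of inversions by exactly one, up or down.\<close>

lemma card_invs_word_le: "set is \<subseteq> {1..<r} \<Longrightarrow> card (invs r (word_perm is)) \<le> length is"
proof (induction "is" rule: rev_induct)
  case Nil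
  show ?case by (simp add: invs_id)
next
  case (snoc i "is")
  let ?u = "word_perm is"
  have "?u i \<noteq> ?u (Suc i)"
    using symgrp_inj[OF word_perm_symgrp, of "is" r i "Suc i"] snoc.prems by simp
  then consider "?u i < ?u (Suc i)" | "?u (Suc i) < ?u i" by linarith
  then show ?case
    using snoc card_invs_simple_refl[of i r ?u] card_invs_simple_refl'[of i r ?u]
    by cases (subst word_perm_snoc, simp)+
qed

text \<open>A permutation other than the identity has a descent. Undoing it by a simple reflection
  on the right removes one inversion, and that reflection becomes the last letter of the
  word.\<close>

lemma ex_word_card_invs:
  "u \<in> symgrp r \<Longrightarrow> \<exists>is. set is \<subseteq> {1..<r} \<and> word_perm is = u \<and> length is = card (invs r u)"
proof (induction "card (invs r u)" arbitrary: u rule: less_induct)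
  case less
  show ?case
  proof (cases "u = id")
    case True
    then show ?thesis by (intro exI[of _ "[]"]) (simp add: invs_id)
  next
    case False
    then obtain i where i: "i \<in> {1..<r}" "\<not> u i < u (Suc i)"
      using symgrp_no_descent less.prems by blast
    then have desc: "u (Suc i) < u i"
      using symgrp_inj[OF less.prems, of i "Suc i"] by simp
    let ?v = "u \<circ> simple_refl i"
    have card: "card (invs r u) = Suc (card (invs r ?v))"
      using card_invs_simple_refl'[OF i(1) desc] .
    have "?v \<in> symgrp r" using less.prems i(1) by (simp add: symgrp_comp simple_refl_symgrp)
    then obtain "is" where "is": "set is \<subseteq> {1..<r}" "word_perm is = ?v" "length is = card (invs r ?v)"
      using less.hyps[of ?v] card by auto
    have "word_perm (is @ [i]) = u"
      unfolding word_perm_snoc "is"(2) by (rule comp_simple_refl_cancel)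
    moreover have "set (is @ [i]) \<subseteq> {1..<r}" "length (is @ [i]) = card (invs r u)"
      using "is"(1,3) i(1) card by simp_all
    ultimately show ?thesis by blast
  qed
qed

lemma len_eq_card_invs:
  assumes "u \<in> symgrp r"
  shows "len r u = card (invs r u)"
  unfolding len_def
proof (rule Least_equality)
  show "\<exists>is. set is \<subseteq> {1..<r} \<and> word_perm is = u \<and> length is = card (invs r u)"
    using ex_word_card_invs[OF assms] .
  show "card (invs r u) \<le> k" if "\<exists>is. set is \<subseteq> {1..<r} \<and> word_perm is = u \<and> length is = k" for k
    using that card_invs_word_le by metis
qed

lemma reduced_word:
  assumes "u \<in> symgrp r"
  shows "set (reduced_word r u) \<subseteq> {1..<r}" "word_perm (reduced_word r u) = u"
    "length (reduced_word r u) = len r u"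
proof -
  have "set (reduced_word r u) \<subseteq> {1..<r} \<and> word_perm (reduced_word r u) = u \<and>
      length (reduced_word r u) = len r u"
    unfolding reduced_word_def len_eq_card_invs[OF assms] by (rule someI_ex[OF ex_word_card_invs[OF assms]])
  then show "set (reduced_word r u) \<subseteq> {1..<r}" "word_perm (reduced_word r u) = u"
    "length (reduced_word r u) = len r u" by blast+
qed

lemma len_simple_refl: "i \<in> {1..<r} \<Longrightarrow> len r (simple_refl i) = 1"
proof -
  assume i: "i \<in> {1..<r}"
  then show ?thesis
    using card_invs_simple_refl[of i r id] by (simp add: len_eq_card_invs simple_refl_symgrp invs_id)
qed

text \<open>The factor of an inversion depends only on the two values there, which a renaming of
  positions does not affect. The extra factor belongs to the new inversion, with the larger value
  first.\<close>

lemma prod_invs_simple_refl: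
  fixes G :: "nat \<Rightarrow> nat \<Rightarrow> 'a::comm_monoid_mult"
  assumes "i \<in> {1..<r}" "u i < u (Suc i)"
  shows "(\<Prod>(k, l)\<in>invs r (u \<circ> simple_refl i). G ((u \<circ> simple_refl i) k) ((u \<circ> simple_refl i) l)) =
    G (u (Suc i)) (u i) * (\<Prod>(k, l)\<in>invs r u. G (u k) (u l))"
  using invs_simple_refl[where u = u, OF assms]
  by (simp add: prod.reindex inj_map_prod_simple_refl case_prod_unfold)

section \<open>Multiplication in the Hecke algebra\<close>

context hecke_algebra
begin

lemma T_expansion: "x = (\<Sum>w\<in>symgrp r. scale (representation (T ` symgrp r) x (T w)) (T w))"
proof -
  have "x = (\<Sum>b\<in>T ` symgrp r. scale (representation (T ` symgrp r) x b) b)"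
    by (rule sum_representation_eq[symmetric]) (simp_all add: T_indep T_span)
  then show ?thesis unfolding sum.reindex[OF T_inj] comp_def .
qed

lemma T_coeff_eq:
  assumes "(\<Sum>w\<in>symgrp r. scale (a w) (T w)) = (\<Sum>w\<in>symgrp r. scale (b w) (T w))" "w \<in> symgrp r"
  shows "a w = b w"
proof -
  \<comment> \<open>Independence speaks of a set of basis elements, so coefficients indexed by
    permutations are moved along the inverse of \<open>T\<close>.\<close>
  let ?g = "inv_into (symgrp r) T"
  have inv: "?g (T w) = w" if "w \<in> symgrp r" for w
    using that T_inj by simp
  have "(\<Sum>x\<in>T ` symgrp r. scale (a (?g x) - b (?g x)) x) = (\<Sum>w\<in>symgrp r. scale (a w - b w) (T w))"
    by (simp add: sum.reindex[OF T_inj] inv cong: sum.cong)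
  also have "\<dots> = 0"
    using assms(1) by (simp add: scale_left_diff_distrib sum_subtractf)
  finally have "a (?g (T w)) - b (?g (T w)) = 0"
    using assms(2) by (intro independentD[OF T_indep, of "T ` symgrp r"]) auto
  then show ?thesis using inv[OF assms(2)] by simp
qed

text \<open>The identity has length 0, so \<open>T id\<close> is a left unit on every basis element;
  expanding 1 in the basis then identifies it.\<close>

lemma T_id: "T id = 1"
proof -
  have "len r id = 0"
    using len_eq_card_invs[of id r] by (simp add: invs_id)
  then have "T id * T w = T w" if "w \<in> symgrp r" for w
    using T_mult[of id w] that by simp
  then have "T id * (\<Sum>w\<in>symgrp r. scale (c w) (T w)) = (\<Sum>w\<in>symgrp r. scale (c w) (T w))" for c
    by (simp add: sum_distrib_left scale_mult_right[symmetric])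
  then have "T id * 1 = 1"
    using T_expansion[of 1] by metis
  then show ?thesis by simp
qed

lemma T_mult_simple_refl:
  assumes "u \<in> symgrp r" "i \<in> {1..<r}" "u i < u (Suc i)"
  shows "T u * T (simple_refl i) = T (u \<circ> simple_refl i)"
proof (rule T_mult)
  show "len r (u \<circ> simple_refl i) = len r u + len r (simple_refl i)"
    using assms by (simp add: len_simple_refl)
      (simp add: len_eq_card_invs symgrp_comp simple_refl_symgrp card_invs_simple_refl)
qed (use assms in \<open>simp_all add: simple_refl_symgrp\<close>)

text \<open>The longer element of the pair factors as \<open>T u * T (simple_refl i)\<close>, which
  brings in the quadratic relation.\<close>

lemma T_mult_simple_refl':
  assumes "u \<in> symgrp r" "i \<in> {1..<r}" "u i < u (Suc i)"
  shows "T (u \<circ> simple_refl i) * T (simple_refl i) = scale (qq - 1) (T (u \<circ> simple_refl i)) + scale qq (T u)"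
proof -
  have "T (u \<circ> simple_refl i) * T (simple_refl i) = T u * (T (simple_refl i) * T (simple_refl i))"
    by (simp add: T_mult_simple_refl[OF assms, symmetric] mult.assoc)
  also have "\<dots> = scale (qq - 1) (T (u \<circ> simple_refl i)) + scale qq (T u)"
    by (simp add: T_quadratic[OF assms(2)] distrib_left scale_mult_right[symmetric] T_mult_simple_refl[OF assms])
  finally show ?thesis .
qed

text \<open>In a reduced word every letter is an ascent of the product before it, so each step is a
  length-additive multiplication.\<close>

lemma T_reduced:
  assumes "u \<in> symgrp r"
  shows "T u = foldl (\<lambda>x i. x * T (simple_refl i)) 1 (reduced_word r u)"
proof -
  \<comment> \<open>The reverse of the inequality assumed here holds for all words, so it says that
    the word is reduced, in a form that passes to prefixes.\<close>
  have "T (word_perm is) = foldl (\<lambda>x i. x * T (simple_refl i)) 1 is"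
    if "set is \<subseteq> {1..<r}" "length is \<le> card (invs r (word_perm is))" for "is"
    using that
  proof (induction "is" rule: rev_induct)
    case (snoc i "is")
    let ?u = "word_perm is"
    have u: "?u \<in> symgrp r" using snoc.prems by (simp add: word_perm_symgrp)
    have le: "card (invs r ?u) \<le> length is" using card_invs_word_le snoc.prems by simp
    have i: "i \<in> {1..<r}" using snoc.prems by simp
    have card_snoc: "card (invs r (word_perm (is @ [i]))) = card (invs r (?u \<circ> simple_refl i))"
      by (simp only: word_perm_snoc)
    have "?u i < ?u (Suc i)"
    proof (rule ccontr)
      \<comment> \<open>A descent would leave the full word with fewer inversions than
        letters.\<close>
      assume "\<not> ?u i < ?u (Suc i)"
      then have "?u (Suc i) < ?u i" using symgrp_inj[OF u, of i "Suc i"] by simp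
      then show False
        using card_invs_simple_refl'[OF i, of ?u] snoc.prems le by (simp add: card_snoc)
    qed
    then have "T (word_perm (is @ [i])) = T ?u * T (simple_refl i)"
      using T_mult_simple_refl[OF u i] by (metis word_perm_snoc)
    moreover have "length is \<le> card (invs r ?u)"
      using card_invs_simple_refl[OF i \<open>?u i < ?u (Suc i)\<close>] snoc.prems
      by (simp add: card_snoc)
    ultimately show ?case using snoc by simp
  qed (simp add: T_id)
  from this[of "reduced_word r u"] show ?thesis
    using reduced_word[OF assms] len_eq_card_invs[OF assms] by simp
qed

end

section \<open>Words of given content\<close>

text \<open>The weakly increasing word of content \<nu>. Blocks are counted from 0 and letters from
  1, hence the \<open>Suc\<close>; the value \<open>undefined\<close> outside places it in the
  extensional function space \<open>words\<close>.\<close>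

definition sorted_word :: "nat list \<Rightarrow> nat \<Rightarrow> nat" where
  "sorted_word \<nu> k =
     (if k \<in> {1..sum_list \<nu>} then Suc (LEAST j. k \<le> sum_list (take (Suc j) \<nu>)) else undefined)"

lemma sum_list_take_mono:
  fixes \<nu> :: "nat list"
  shows "i \<le> j \<Longrightarrow> sum_list (take i \<nu>) \<le> sum_list (take j \<nu>)"
  by (metis le_add1 min.absorb1 sum_list_append take_add le_Suc_ex)

lemma sum_list_take_le: "sum_list (take i \<nu>) \<le> sum_list (\<nu> :: nat list)"
  by (metis append_take_drop_id le_add1 sum_list_append)

lemma block_subset: "block \<nu> j \<subseteq> {1..sum_list \<nu>}"
proof
  fix k assume k: "k \<in> block \<nu> j"
  then have "k \<le> sum_list (take (Suc j) \<nu>)" "1 \<le> k" by (auto simp: block_def)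
  then show "k \<in> {1..sum_list \<nu>}" using sum_list_take_le[of "Suc j" \<nu>] by auto
qed

lemma sorted_word_block:
  assumes "k \<in> block \<nu> j"
  shows "sorted_word \<nu> k = Suc j"
proof -
  have k: "sum_list (take j \<nu>) < k" "k \<le> sum_list (take (Suc j) \<nu>)"
    using assms unfolding block_def greaterThanAtMost_iff by blast+
  have "(LEAST j. k \<le> sum_list (take (Suc j) \<nu>)) = j"
  proof (rule Least_equality)
    fix y assume y: "k \<le> sum_list (take (Suc y) \<nu>)"
    show "j \<le> y"
    proof (rule ccontr)
      assume "\<not> j \<le> y"
      then have "sum_list (take (Suc y) \<nu>) \<le> sum_list (take j \<nu>)" by (intro sum_list_take_mono) simp
      then show False using y k by simp
    qed
  qed (rule k)
  moreover have "k \<in> {1..sum_list \<nu>}" using block_subset assms by blast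
  ultimately show ?thesis unfolding sorted_word_def by (simp only: if_True)
qed

text \<open>The block ends at the first partial sum that reaches \<open>k\<close>; its index is a
  successor because \<open>k\<close> exceeds the empty sum.\<close>

lemma ex_block:
  assumes "k \<in> {1..sum_list \<nu>}"
  shows "\<exists>j<length \<nu>. k \<in> block \<nu> j"
proof -
  let ?P = "\<lambda>j. k \<le> sum_list (take j \<nu>)"
  define j where "j = (LEAST j. ?P j)"
  have P: "?P (length \<nu>)" using assms by simp
  then have j: "?P j" "j \<le> length \<nu>"
    unfolding j_def by (rule LeastI, rule Least_le)
  then obtain i where i: "j = Suc i" using assms by (cases j) auto
  have "\<not> ?P i" using not_less_Least[of i ?P] i unfolding j_def by simp
  then show ?thesis using j i unfolding block_def by (intro exI[of _ i]) auto
qed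

lemma sorted_word_eq_Suc_iff:
  assumes "k \<in> {1..sum_list \<nu>}"
  shows "sorted_word \<nu> k = Suc j \<longleftrightarrow> k \<in> block \<nu> j"
  using ex_block[OF assms] sorted_word_block by fastforce

lemma sorted_word_range: "k \<in> {1..sum_list \<nu>} \<Longrightarrow> sorted_word \<nu> k \<in> {1..length \<nu>}"
  using ex_block[of k \<nu>] sorted_word_block by fastforce

lemma sorted_word_mono:
  assumes "k \<in> {1..sum_list \<nu>}" "l \<in> {1..sum_list \<nu>}" "k \<le> l"
  shows "sorted_word \<nu> k \<le> sorted_word \<nu> l"
proof -
  obtain i j where ij: "k \<in> block \<nu> i" "l \<in> block \<nu> j" using ex_block assms by metis
  have "i \<le> j"
  proof (rule ccontr)
    assume "\<not> i \<le> j"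
    then have "sum_list (take (Suc j) \<nu>) \<le> sum_list (take i \<nu>)" by (intro sum_list_take_mono) simp
    then show False using ij assms(3) unfolding block_def by auto
  qed
  then show ?thesis using ij by (simp add: sorted_word_block)
qed

lemma card_block: "j < length \<nu> \<Longrightarrow> card (block \<nu> j) = \<nu> ! j"
  by (simp add: block_def take_Suc_conv_app_nth)

lemma sorted_word_append:
  assumes "k \<in> {1..sum_list xs + sum_list ys}"
  shows "sorted_word (xs @ ys) k =
    (if k \<le> sum_list xs then sorted_word xs k else length xs + sorted_word ys (k - sum_list xs))"
proof (cases "k \<le> sum_list xs")
  case True
  then obtain j where j: "j < length xs" "k \<in> block xs j" using ex_block[of k xs] assms by auto
  then have "k \<in> block (xs @ ys) j" by (simp add: block_def)
  then show ?thesis using True j(2) by (simp add: sorted_word_block)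
next
  case False
  then obtain j where j: "k - sum_list xs \<in> block ys j"
    using ex_block[of "k - sum_list xs" ys] assms by force
  have "k \<in> block (xs @ ys) (length xs + j)"
    using j False unfolding block_def by auto
  then show ?thesis using False j by (simp add: sorted_word_block)
qed

lemma sorted_word_replicate:
  assumes "k \<in> {1..N}"
  shows "sorted_word (replicate N 1) k = k"
proof -
  have "k \<in> block (replicate N 1) (k - 1)"
    using assms by (auto simp: block_def sum_list_replicate min_def)
  then show ?thesis using assms sorted_word_block[of k _ "k - 1"] by simp
qed

text \<open>The blocks are the fibres of the sorted word. Conversely, an injective map of a finite
  block into itself is onto.\<close>

lemma young_eq_stabilizer:
  assumes "sum_list \<nu> = r"
  shows "young r \<nu> = {w \<in> symgrp r. \<forall>k\<in>{1..r}. sorted_word \<nu> (w k) = sorted_word \<nu> k}"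
proof (intro equalityI subsetI CollectI conjI ballI)
  fix w k assume w: "w \<in> young r \<nu>" and k: "k \<in> {1..r}"
  obtain j where j: "j < length \<nu>" "k \<in> block \<nu> j" using ex_block[of k \<nu>] k assms by auto
  then have "w k \<in> block \<nu> j" using w by (auto simp: young_def)
  then show "sorted_word \<nu> (w k) = sorted_word \<nu> k" using j sorted_word_block by metis
next
  fix w assume "w \<in> {w \<in> symgrp r. \<forall>k\<in>{1..r}. sorted_word \<nu> (w k) = sorted_word \<nu> k}"
  then have w: "w \<in> symgrp r" and eq: "\<And>k. k \<in> {1..r} \<Longrightarrow> sorted_word \<nu> (w k) = sorted_word \<nu> k" by auto
  have "w ` block \<nu> j = block \<nu> j" for j
  proof (rule endo_inj_surj)
    show "w ` block \<nu> j \<subseteq> block \<nu> j"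
    proof (rule image_subsetI)
      fix k assume k: "k \<in> block \<nu> j"
      then have "k \<in> {1..r}" using block_subset assms by blast
      then show "w k \<in> block \<nu> j"
        using eq[of k] k symgrp_mem[OF w, of k] assms sorted_word_eq_Suc_iff sorted_word_block by metis
    qed
    show "inj_on w (block \<nu> j)" using symgrp_inj[OF w] by (simp add: inj_on_def)
  qed (simp add: block_def)
  then show "w \<in> young r \<nu>" using w by (simp add: young_def)
qed (auto simp: young_def)

lemma sorted_word_words:
  assumes "(lam, mu) \<in> Lam m n r"
  shows "sorted_word (lam @ mu) \<in> words m n r"
proof -
  have "length (lam @ mu) = m + n" "sum_list (lam @ mu) = r" using assms by (simp_all add: Lam_def)
  then show ?thesis
    unfolding words_def
    by (intro PiE_I) (use sorted_word_range[of _ "lam @ mu"] in force, simp only: sorted_word_def if_False)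
qed

lemma words_comp_symgrp:
  assumes "w \<in> words m n r" "u \<in> symgrp r"
  shows "w \<circ> u \<in> words m n r"
  unfolding words_def
proof (rule PiE_I)
  show "(w \<circ> u) k \<in> {1..m + n}" if "k \<in> {1..r}" for k
    using that assms symgrp_mem[OF assms(2), of k] by (auto simp: words_def PiE_iff)
  show "(w \<circ> u) k = undefined" if "k \<notin> {1..r}" for k
    using that assms symgrp_mem[OF assms(2), of k] by (auto simp: words_def PiE_iff extensional_def)
qed

lemma finite_words [simp]: "finite (words m n r)"
  by (simp add: words_def finite_PiE)

section \<open>Contents, and the words of one content as a single orbit\<close>

definition content :: "nat \<Rightarrow> nat \<Rightarrow> nat \<Rightarrow> (nat \<Rightarrow> nat) \<Rightarrow> nat list \<times> nat list" where
  "content m n r w =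
     (map (\<lambda>j. card {k \<in> {1..r}. w k = Suc j}) [0..<m],
      map (\<lambda>j. card {k \<in> {1..r}. w k = Suc j}) [m..<m + n])"

lemma content_append:
  "fst (content m n r w) @ snd (content m n r w) = map (\<lambda>j. card {k \<in> {1..r}. w k = Suc j}) [0..<m + n]"
  by (simp only: content_def fst_conv snd_conv upt_add_eq_append[OF le0] map_append)

text \<open>Every position carries exactly one letter from {1..m+n}, so the fibres of
  \<open>w\<close> partition the r positions.\<close>

lemma content_Lam:
  assumes "w \<in> words m n r"
  shows "content m n r w \<in> Lam m n r"
proof -
  have "{1..r} = (\<Union>j\<in>{0..<m + n}. {k \<in> {1..r}. w k = Suc j})"
  proof (intro equalityI subsetI)
    fix k assume k: "k \<in> {1..r}"
    then have "w k \<in> {1..m + n}" using assms by (auto simp: words_def)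
    then show "k \<in> (\<Union>j\<in>{0..<m + n}. {k \<in> {1..r}. w k = Suc j})"
      using k by (intro UN_I[of "w k - 1"]) auto
  qed auto
  then have "r = card (\<Union>j\<in>{0..<m + n}. {k \<in> {1..r}. w k = Suc j})"
    by (metis card_atLeastAtMost diff_Suc_1)
  also have "\<dots> = (\<Sum>j\<in>{0..<m + n}. card {k \<in> {1..r}. w k = Suc j})"
    by (rule card_UN_disjoint) auto
  also have "\<dots> = sum_list (fst (content m n r w) @ snd (content m n r w))"
    by (simp only: content_append interv_sum_list_conv_sum_set_nat set_upt)
  finally show ?thesis by (simp add: Lam_def content_def)
qed

lemma content_sorted_word:
  assumes p: "(lam, mu) \<in> Lam m n r" and u: "u \<in> symgrp r"
  shows "content m n r (sorted_word (lam @ mu) \<circ> u) = (lam, mu)"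
proof -
  let ?\<nu> = "lam @ mu"
  have len: "length lam = m" "length mu = n" "sum_list ?\<nu> = r" using p by (auto simp: Lam_def)
  have card: "card {k \<in> {1..r}. (sorted_word ?\<nu> \<circ> u) k = Suc j} = ?\<nu> ! j" if "j < m + n" for j
  proof -
    have "bij_betw u {k \<in> {1..r}. (sorted_word ?\<nu> \<circ> u) k = Suc j} (block ?\<nu> j)"
    proof (rule bij_betw_imageI)
      show "inj_on u {k \<in> {1..r}. (sorted_word ?\<nu> \<circ> u) k = Suc j}"
        using symgrp_inj[OF u] by (simp add: inj_on_def)
      have "\<exists>l. k = u l" for k using u unfolding symgrp_def by (metis mem_Collect_eq permutes_surj surjD)
      moreover have "u l \<in> block ?\<nu> j \<longleftrightarrow> l \<in> {1..r} \<and> sorted_word ?\<nu> (u l) = Suc j" for l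
        using sorted_word_eq_Suc_iff[of "u l" ?\<nu> j] block_subset[of ?\<nu> j] symgrp_mem[OF u, of l] len(3)
        by blast
      ultimately show "u ` {k \<in> {1..r}. (sorted_word ?\<nu> \<circ> u) k = Suc j} = block ?\<nu> j"
        by (fastforce simp del: atLeastAtMost_iff)
    qed
    then show ?thesis using card_block[of j ?\<nu>] that len by (simp add: bij_betw_same_card)
  qed
  have "map ((!) ?\<nu>) [0..<m] = lam" "map ((!) ?\<nu>) [m..<m + n] = mu"
    by (rule nth_equalityI; simp add: len nth_append)+
  moreover have "map (\<lambda>j. card {k \<in> {1..r}. (sorted_word ?\<nu> \<circ> u) k = Suc j}) [a..<b] = map ((!) ?\<nu>) [a..<b]"
    if "b \<le> m + n" for a b
    using that by (intro map_cong refl card) simp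
  ultimately show ?thesis by (simp only: content_def le_add1 order_refl)
qed

text \<open>Equal content means equal multisets of letters, and then the two words differ by a
  permutation of the positions.\<close>

lemma word_eq_sorted_word_comp:
  assumes w: "w \<in> words m n r"
  obtains u where "u \<in> symgrp r"
    "w = sorted_word (fst (content m n r w) @ snd (content m n r w)) \<circ> u"
proof -
  define v where "v = sorted_word (fst (content m n r w) @ snd (content m n r w))"
  have L: "content m n r w \<in> Lam m n r" by (rule content_Lam[OF w])
  have v: "v \<in> words m n r" unfolding v_def
    by (rule sorted_word_words) (use L in simp)
  have "content m n r v = content m n r w"
    using content_sorted_word[of "fst (content m n r w)" "snd (content m n r w)" m n r id] L
    by (simp add: v_def)
  then have "map (\<lambda>j. card {k \<in> {1..r}. v k = Suc j}) [0..<m + n] =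
      map (\<lambda>j. card {k \<in> {1..r}. w k = Suc j}) [0..<m + n]"
    by (metis content_append)
  then have card: "card {k \<in> {1..r}. v k = Suc j} = card {k \<in> {1..r}. w k = Suc j}" if "j < m + n" for j
    using that by (simp add: map_eq_conv)
  have "image_mset w (mset_set {1..r}) = image_mset v (mset_set {1..r})"
  proof (rule multiset_eqI)
    fix c :: nat
    have count: "count (image_mset x (mset_set {1..r})) c = card {k \<in> {1..r}. x k = c}" for x :: "nat \<Rightarrow> nat" and c
      by (subst count_image_mset) (auto simp: vimage_def Int_def conj_commute intro: arg_cong[of _ _ card])
    have out: "card {k \<in> {1..r}. x k = c} = 0" if "x \<in> words m n r" "c \<notin> {1..m + n}" for x c
      using that by (auto simp: words_def PiE_iff)
    show "count (image_mset w (mset_set {1..r})) c = count (image_mset v (mset_set {1..r})) c"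
    proof (cases "c \<in> {1..m + n}")
      case True
      then show ?thesis unfolding count using card[of "c - 1"] by auto
    qed (simp only: count out w v not_False_eq_True)
  qed
  then obtain u where u: "u permutes {1..r}" "\<forall>k\<in>{1..r}. w k = v (u k)"
    using image_mset_eq_implies_permutes[of "{1..r}" w v] by auto
  \<comment> \<open>Outside {1..r} both words are \<open>undefined\<close> and \<open>u\<close>
    fixes the point.\<close>
  have "w k = v (u k)" for k
  proof (cases "k \<in> {1..r}")
    case False
    then have "u k = k" using u(1) by (simp add: permutes_not_in)
    then show ?thesis using False v w by (auto simp: words_def PiE_iff extensional_def)
  qed (use u in auto)
  then show thesis using that[of u] u(1) by (simp add: v_def symgrp_def fun_eq_iff)
qed

section \<open>The intertwining maps\<close>

lemma vv_vinv [simp]: "vv * vinv = 1" "vinv * vv = 1"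
  by (simp_all add: vv_def vinv_def mult_single)

lemma qq_qinv [simp]: "qq * qinv = 1" "qinv * qq = 1"
  by (simp_all add: qq_def qinv_def power_mult_distrib[symmetric])

lemma vinv_nonzero: "vinv \<noteq> 0"
  using vv_vinv by fastforce

lemma qinv_nonzero: "qinv \<noteq> 0"
  using qq_qinv by fastforce

text \<open>\<open>- qinv\<close> is the weight of a reflection in \<open>y\<^sub>\<mu>\<close>; for \<open>c > d\<close> the value is forced by
  \<open>T s\<^sub>i = v R\<close>, which sends \<open>e\<^sub>d \<otimes> e\<^sub>c\<close> to a signed multiple of \<open>v e\<^sub>c \<otimes> e\<^sub>d\<close>.\<close>

definition chi :: "nat \<Rightarrow> nat \<Rightarrow> nat \<Rightarrow> laurent" where
  "chi m c d = (if c = d then if c \<le> m then 1 else - qinv else bsign (hat m c * hat m d) vinv)"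

lemma chi_nonzero: "chi m c d \<noteq> 0"
  by (simp add: chi_def bsign_def vinv_nonzero qinv_nonzero)

definition inv_coeff :: "nat \<Rightarrow> nat \<Rightarrow> (nat \<Rightarrow> nat) \<Rightarrow> (nat \<Rightarrow> nat) \<Rightarrow> laurent" where
  "inv_coeff m r w0 u = (\<Prod>(k, l)\<in>invs r u. chi m (w0 (u k)) (w0 (u l)))"

lemma inv_coeff_nonzero: "inv_coeff m r w0 u \<noteq> 0"
  by (auto simp: inv_coeff_def chi_nonzero)

lemma inv_coeff_simple_refl:
  assumes "i \<in> {1..<r}" "u i < u (Suc i)"
  shows "inv_coeff m r w0 (u \<circ> simple_refl i) = chi m (w0 (u (Suc i))) (w0 (u i)) * inv_coeff m r w0 u"
  unfolding inv_coeff_def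
  using prod_invs_simple_refl[where G = "\<lambda>a b. chi m (w0 a) (w0 b)", OF assms] .

text \<open>The diagonal entry of the matrix of R at the basis vector with letters \<open>c\<close>,
  \<open>d\<close> in the two factors.\<close>

definition diag_coeff :: "nat \<Rightarrow> nat \<Rightarrow> nat \<Rightarrow> laurent" where
  "diag_coeff m c d =
    (if c = d then if c \<le> m then vv else - vinv else if d < c then vv - vinv else 0)"

text \<open>The following two identities compare the coefficients of \<open>T u\<close> and \<open>T (u s\<^sub>i)\<close> for \<open>u i < u (i+1)\<close>,
  with \<open>c, d\<close> the letters of \<open>w = w\<^sub>0 \<circ> u\<close> at \<open>i, i+1\<close>, and \<open>x, y\<close> the values of the tensor at
  \<open>w\<close> and \<open>w s\<^sub>i\<close>.\<close>

lemma exchange_ascent: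
  fixes x y k :: laurent
  assumes "c \<le> d" "c = d \<Longrightarrow> y = x"
  shows "vv * ((diag_coeff m c d * x + (if c \<noteq> d then bsign (hat m c * hat m d) y else 0)) * k) =
    qq * (y * (chi m d c * k))"
proof -
  consider "c = d" "c \<le> m" | "c = d" "m < c" | "c < d" using assms(1) by linarith
  then show ?thesis
  proof cases
    case 1
    then show ?thesis using assms(2)
      by (simp add: diag_coeff_def chi_def qq_def power2_eq_square mult.assoc)
  next
    case 2
    then have "vv * ((diag_coeff m c d * x + (if c \<noteq> d then bsign (hat m c * hat m d) y else 0)) * k) =
        - ((vv * vinv) * (x * k))"
      by (simp add: diag_coeff_def mult.assoc del: vv_vinv)
    \<comment> \<open>Both products are 1; the exchange brings out the factor \<open>- qinv\<close>
      of \<open>chi\<close>.\<close>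
    also have "\<dots> = - ((qq * qinv) * (x * k))" by simp
    also have "\<dots> = qq * (y * (chi m d c * k))"
      using 2 assms(2) by (simp add: chi_def mult_ac del: qq_qinv)
    finally show ?thesis .
  next
    case 3
    have "qq * (y * (chi m d c * k)) = vv * (vv * vinv) * bsign (hat m c * hat m d) (y * k)"
      using 3 by (simp add: chi_def qq_def power2_eq_square bsign_def mult_ac del: vv_vinv)
    then show ?thesis using 3 by (simp add: diag_coeff_def bsign_def)
  qed
qed

lemma exchange_descent:
  fixes x y k :: laurent
  assumes "c \<le> d" "c = d \<Longrightarrow> y = x"
  shows "vv * ((diag_coeff m d c * y + (if d \<noteq> c then bsign (hat m d * hat m c) x else 0)) * (chi m d c * k)) =
    x * k + (qq - 1) * (y * (chi m d c * k))"
proof -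
  consider "c = d" "c \<le> m" | "c = d" "m < c" | "c < d" using assms(1) by linarith
  then show ?thesis
  proof cases
    case 1
    then show ?thesis using assms(2)
      by (simp add: diag_coeff_def chi_def qq_def power2_eq_square algebra_simps)
  next
    case 2
    then have "vv * ((diag_coeff m d c * y + (if d \<noteq> c then bsign (hat m d * hat m c) x else 0)) * (chi m d c * k)) =
        (vv * vinv) * (qinv * (x * k))"
      using assms(2) by (simp add: diag_coeff_def chi_def mult_ac del: vv_vinv)
    also have "\<dots> = x * k - (qq * qinv) * (x * k) + qinv * (x * k)" by simp
    also have "\<dots> = x * k + (qq - 1) * (y * (chi m d c * k))"
      using 2 assms(2) by (simp add: chi_def algebra_simps del: qq_qinv)
    finally show ?thesis .
  next
    case 3
    \<comment> \<open>The off-diagonal entry of R and \<open>chi\<close> carry the same sign, so in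
      the term with \<open>x\<close> it appears twice and cancels.\<close>
    define e where "e = hat m d * hat m c"
    have "vv * ((diag_coeff m d c * y + (if d \<noteq> c then bsign (hat m d * hat m c) x else 0)) * (chi m d c * k)) =
        (vv * vinv) * (x * k) + vv * vv * (y * (chi m d c * k)) - (vv * vinv) * (y * (chi m d c * k))"
      using 3 unfolding e_def[symmetric] chi_def
      by (simp add: diag_coeff_def bsign_def algebra_simps del: vv_vinv)
    then show ?thesis by (simp add: qq_def power2_eq_square algebra_simps)
  qed
qed

text \<open>\<open>R_basis\<close> is given by the letters of its source, while the coefficient
  comparison needs the letters of the target \<open>w\<close>. The sign is symmetric in the two
  letters, and swapping equal letters fixes a word, so that case belongs to the diagonal.\<close>

lemma R_basis_apply:
  "R_basis m i w' w =
    (if w' = w then diag_coeff m (w i) (w (Suc i)) else 0) +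
    (if w' = w \<circ> simple_refl i \<and> w i \<noteq> w (Suc i)
     then bsign (hat m (w i) * hat m (w (Suc i))) 1 else 0)"
proof -
  have sw: "w = w' \<circ> simple_refl i \<longleftrightarrow> w' = w \<circ> simple_refl i"
    by (metis comp_simple_refl_cancel)
  consider "w' = w" | "w' \<noteq> w" "w' = w \<circ> simple_refl i" | "w' \<noteq> w" "w' \<noteq> w \<circ> simple_refl i"
    by blast
  then show ?thesis
  proof cases
    case 1
    have "w = w \<circ> simple_refl i \<Longrightarrow> w i = w (Suc i)" by (metis comp_apply simple_refl_apply(1))
    then show ?thesis using 1
      by (auto simp: R_basis_def Let_def diag_coeff_def lscale_def ebasis_def bsign_def sw)
  next
    case 2
    have "w i = w (Suc i) \<Longrightarrow> w \<circ> simple_refl i = w" by (auto simp: fun_eq_iff simple_refl_def transpose_def)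
    then have "w i \<noteq> w (Suc i)" using 2 by auto
    moreover have "w' i = w (Suc i)" "w' (Suc i) = w i" using 2 by simp_all
    ultimately show ?thesis using 2 sw
      by (auto simp: R_basis_def Let_def diag_coeff_def lscale_def ebasis_def bsign_def mult.commute)
  next
    case 3
    then show ?thesis using sw
      by (auto simp: R_basis_def Let_def diag_coeff_def lscale_def ebasis_def bsign_def)
  qed
qed

lemma R_op_apply:
  assumes w: "w \<in> words m n r" and i: "i \<in> {1..<r}"
  shows "R_op m n r i f w = diag_coeff m (w i) (w (Suc i)) * f w +
    (if w i \<noteq> w (Suc i)
     then bsign (hat m (w i) * hat m (w (Suc i))) (f (w \<circ> simple_refl i)) else 0)"
proof -
  have ws: "w \<circ> simple_refl i \<in> words m n r"
    by (rule words_comp_symgrp[OF w simple_refl_symgrp[OF i]])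
  have sum_apply: "(\<Sum>x\<in>A. F x) w = (\<Sum>x\<in>A. F x w)" for A and F :: "(nat \<Rightarrow> nat) \<Rightarrow> (nat \<Rightarrow> nat) \<Rightarrow> laurent"
    by (induction A rule: infinite_finite_induct) simp_all
  have "R_op m n r i f w = (\<Sum>w'\<in>words m n r. f w' * R_basis m i w' w)"
    by (simp add: R_op_def sum_apply lscale_def)
  also have "\<dots> = (\<Sum>w'\<in>words m n r.
      (if w' = w then f w' * diag_coeff m (w i) (w (Suc i)) else 0) +
      (if w' = w \<circ> simple_refl i then if w i \<noteq> w (Suc i)
       then f w' * bsign (hat m (w i) * hat m (w (Suc i))) 1 else 0 else 0))"
    unfolding R_basis_apply by (rule sum.cong) (auto simp: distrib_left)
  also have "\<dots> = f w * diag_coeff m (w i) (w (Suc i)) + (if w i \<noteq> w (Suc i)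
       then f (w \<circ> simple_refl i) * bsign (hat m (w i) * hat m (w (Suc i))) 1 else 0)"
    using w ws by (simp add: sum.distrib)
  finally show ?thesis by (simp add: bsign_def mult.commute)
qed

section \<open>Stability of the tensor space under R and the Hecke action\<close>

lemma R_basis_tensor_space:
  assumes "w \<in> words m n r" "i \<in> {1..<r}"
  shows "R_basis m i w \<in> tensor_space m n r"
  unfolding tensor_space_def mem_Collect_eq
proof (intro allI impI)
  fix u assume u: "u \<notin> words m n r"
  have "w \<circ> simple_refl i \<in> words m n r"
    using assms by (simp add: words_comp_symgrp simple_refl_symgrp)
  then have "w \<noteq> u" "u \<circ> simple_refl i \<noteq> w"
    using u assms(1) by auto
  then show "R_basis m i w u = 0" by (auto simp: R_basis_apply)
qed

lemma zero_tensor_space: "0 \<in> tensor_space m n r"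
  by (simp add: tensor_space_def)

lemma add_tensor_space: "f \<in> tensor_space m n r \<Longrightarrow> g \<in> tensor_space m n r \<Longrightarrow> f + g \<in> tensor_space m n r"
  by (simp add: tensor_space_def)

lemma diff_tensor_space: "f \<in> tensor_space m n r \<Longrightarrow> g \<in> tensor_space m n r \<Longrightarrow> f - g \<in> tensor_space m n r"
  by (simp add: tensor_space_def)

lemma lscale_tensor_space: "f \<in> tensor_space m n r \<Longrightarrow> lscale c f \<in> tensor_space m n r"
  by (simp add: tensor_space_def lscale_def)

lemma sum_tensor_space: "(\<And>x. x \<in> A \<Longrightarrow> F x \<in> tensor_space m n r) \<Longrightarrow> (\<Sum>x\<in>A. F x) \<in> tensor_space m n r"
  by (induction A rule: infinite_finite_induct) (simp_all add: zero_tensor_space add_tensor_space)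

lemma R_op_tensor_space: "i \<in> {1..<r} \<Longrightarrow> R_op m n r i f \<in> tensor_space m n r"
  unfolding R_op_def by (intro sum_tensor_space lscale_tensor_space R_basis_tensor_space)

lemma foldl_R_op_tensor_space:
  "set is \<subseteq> {1..<r} \<Longrightarrow> f \<in> tensor_space m n r \<Longrightarrow>
    foldl (\<lambda>g i. R_op m n r i g) f is \<in> tensor_space m n r"
  by (induction "is" rule: rev_induct) (simp_all add: R_op_tensor_space)

lemma tensor_act_tensor_space:
  assumes "f \<in> tensor_space m n r"
  shows "tensor_act m n scale r T f h \<in> tensor_space m n r"
  unfolding tensor_act_def act_T_def
  by (intro sum_tensor_space lscale_tensor_space foldl_R_op_tensor_space reduced_word assms)

context hecke_algebra
begin

text \<open>The linear extension of the assignment on basis vectors: summing over all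
  \<open>u\<close> and reading off \<open>f\<close> at \<open>w0 \<circ> u\<close> groups the terms
  by word, and words outside the orbit of \<open>w0\<close> contribute nothing.\<close>

definition orbit_map :: "nat \<Rightarrow> (nat \<Rightarrow> nat) \<Rightarrow> ((nat \<Rightarrow> nat) \<Rightarrow> laurent) \<Rightarrow> 'h" where
  "orbit_map m w0 f = (\<Sum>u\<in>symgrp r. scale (f (w0 \<circ> u) * inv_coeff m r w0 u) (T u))"

lemma orbit_map_zero: "orbit_map m w0 0 = 0"
  by (simp add: orbit_map_def)

lemma orbit_map_add: "orbit_map m w0 (f + g) = orbit_map m w0 f + orbit_map m w0 g"
  by (simp add: orbit_map_def sum.distrib distrib_right scale_left_distrib)

lemma orbit_map_lscale: "orbit_map m w0 (lscale c f) = scale c (orbit_map m w0 f)"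
  by (simp add: orbit_map_def lscale_def scale_sum_right mult.assoc)

lemma orbit_map_sum: "orbit_map m w0 (\<Sum>x\<in>A. F x) = (\<Sum>x\<in>A. orbit_map m w0 (F x))"
  by (induction A rule: infinite_finite_induct)
     (simp_all only: sum.infinite sum.empty sum.insert orbit_map_zero orbit_map_add not_False_eq_True)

text \<open>The group is split into left cosets of the subgroup generated by the simple reflection,
  each represented by its element with an ascent at \<open>i\<close>.\<close>

lemma sum_symgrp_pairs:
  fixes F :: "(nat \<Rightarrow> nat) \<Rightarrow> 'h"
  assumes i: "i \<in> {1..<r}"
  shows "(\<Sum>u\<in>symgrp r. F u) = (\<Sum>u | u \<in> symgrp r \<and> u i < u (Suc i). F u + F (u \<circ> simple_refl i))"
proof -
  let ?A = "{u \<in> symgrp r. u i < u (Suc i)}" and ?s = "\<lambda>u. u \<circ> simple_refl i"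
  have split: "symgrp r = ?A \<union> ?s ` ?A"
  proof (intro equalityI subsetI)
    fix u assume u: "u \<in> symgrp r"
    show "u \<in> ?A \<union> ?s ` ?A"
    proof (cases "u i < u (Suc i)")
      case False
      then have "u (Suc i) < u i" using symgrp_inj[OF u, of i "Suc i"] by simp
      then have "?s u \<in> ?A" using u i by (simp add: symgrp_comp simple_refl_symgrp)
      moreover have "u = ?s (?s u)" by (rule comp_simple_refl_cancel[symmetric])
      ultimately show ?thesis by blast
    qed (use u in simp)
  qed (use i in \<open>auto simp: symgrp_comp simple_refl_symgrp\<close>)
  have fin: "finite ?A" by simp
  have "inj_on ?s ?A"
    by (rule inj_on_inverseI[of _ ?s]) (rule comp_simple_refl_cancel)
  moreover have "?A \<inter> ?s ` ?A = {}" by auto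
  ultimately have "(\<Sum>u\<in>symgrp r. F u) = (\<Sum>u\<in>?A. F u) + (\<Sum>u\<in>?A. F (?s u))"
    using sum.union_disjoint[of ?A "?s ` ?A" F] sum.reindex[of ?s ?A F] fin
    by (simp only: split[symmetric] finite_imageI comp_def[of F])
  then show ?thesis by (simp only: sum.distrib)
qed

text \<open>Monotonicity of \<open>w0\<close> turns an ascent of \<open>u\<close> at
  \<open>i\<close> into letters \<open>c \<le> d\<close>, as the exchange identities require. They
  match the coefficients of both basis elements of each pair.\<close>

lemma orbit_map_R_op:
  assumes w0: "w0 \<in> words m n r"
    and mono: "\<And>k l. k \<in> {1..r} \<Longrightarrow> l \<in> {1..r} \<Longrightarrow> k \<le> l \<Longrightarrow> w0 k \<le> w0 l"
    and i: "i \<in> {1..<r}"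
  shows "scale vv (orbit_map m w0 (R_op m n r i f)) = orbit_map m w0 f * T (simple_refl i)"
proof -
  let ?s = "simple_refl i" and ?g = "R_op m n r i f" and ?c = "inv_coeff m r w0"
  have "scale vv (orbit_map m w0 ?g) = (\<Sum>u\<in>symgrp r. scale (vv * (?g (w0 \<circ> u) * ?c u)) (T u))"
    by (simp add: orbit_map_def scale_sum_right)
  also have "\<dots> = (\<Sum>u | u \<in> symgrp r \<and> u i < u (Suc i).
      scale (vv * (?g (w0 \<circ> u) * ?c u)) (T u) +
      scale (vv * (?g (w0 \<circ> (u \<circ> ?s)) * ?c (u \<circ> ?s))) (T (u \<circ> ?s)))"
    by (rule sum_symgrp_pairs[OF i])
  also have "\<dots> = (\<Sum>u | u \<in> symgrp r \<and> u i < u (Suc i).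
      scale (f (w0 \<circ> u) * ?c u) (T u) * T ?s +
      scale (f (w0 \<circ> (u \<circ> ?s)) * ?c (u \<circ> ?s)) (T (u \<circ> ?s)) * T ?s)"
  proof (rule sum.cong[OF refl])
    fix u assume "u \<in> {u. u \<in> symgrp r \<and> u i < u (Suc i)}"
    then have u: "u \<in> symgrp r" and less: "u i < u (Suc i)" by auto
    let ?w = "w0 \<circ> u"
    define c d where "c = ?w i" and "d = ?w (Suc i)"
    have "u i \<in> {1..r}" "u (Suc i) \<in> {1..r}" using symgrp_mem[OF u] i by auto
    then have cd: "c \<le> d" using mono less by (simp add: c_def d_def)
    have w: "?w \<in> words m n r" "?w \<circ> ?s \<in> words m n r"
      using w0 u i by (auto intro!: words_comp_symgrp simple_refl_symgrp)
    have cs: "?c (u \<circ> ?s) = chi m d c * ?c u"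
      using inv_coeff_simple_refl[OF i less] by (simp add: c_def d_def)
    have g1: "?g ?w = diag_coeff m c d * f ?w +
        (if c \<noteq> d then bsign (hat m c * hat m d) (f (?w \<circ> ?s)) else 0)"
      using R_op_apply[OF w(1) i] by (simp add: c_def d_def)
    have g2: "?g (?w \<circ> ?s) = diag_coeff m d c * f (?w \<circ> ?s) +
        (if d \<noteq> c then bsign (hat m d * hat m c) (f ?w) else 0)"
      using R_op_apply[OF w(2) i] by (simp only: c_def d_def comp_apply simple_refl_apply comp_simple_refl_cancel)
    have eq_c: "?w \<circ> ?s = ?w" if "c = d"
      using that by (auto simp: c_def d_def fun_eq_iff simple_refl_def transpose_def)
    have fs: "f (?w \<circ> ?s) = f ?w" if "c = d"
      using eq_c[OF that] by (rule arg_cong)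
    have 1: "vv * (?g ?w * ?c u) = qq * (f (?w \<circ> ?s) * ?c (u \<circ> ?s))"
      unfolding cs g1 by (rule exchange_ascent[OF cd fs])
    have 2: "vv * (?g (?w \<circ> ?s) * ?c (u \<circ> ?s)) = f ?w * ?c u + (qq - 1) * (f (?w \<circ> ?s) * ?c (u \<circ> ?s))"
      unfolding cs g2 by (rule exchange_descent[OF cd fs])
    have "scale (f ?w * ?c u) (T u) * T ?s + scale (f (?w \<circ> ?s) * ?c (u \<circ> ?s)) (T (u \<circ> ?s)) * T ?s =
      scale (f ?w * ?c u) (T u * T ?s) + scale (f (?w \<circ> ?s) * ?c (u \<circ> ?s)) (T (u \<circ> ?s) * T ?s)"
      by (simp only: scale_mult_left)
    \<comment> \<open>Multiplying by \<open>T ?s\<close> sends \<open>T u\<close> to the longer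
      element only, but the longer element to both; the terms are collected by basis
      element.\<close>
    also have "\<dots> = scale (qq * (f (?w \<circ> ?s) * ?c (u \<circ> ?s))) (T u) +
      scale (f ?w * ?c u + (qq - 1) * (f (?w \<circ> ?s) * ?c (u \<circ> ?s))) (T (u \<circ> ?s))"
      unfolding T_mult_simple_refl[OF u i less] T_mult_simple_refl'[OF u i less]
      by (simp add: scale_right_distrib scale_left_distrib mult.commute add.assoc)
    finally show "scale (vv * (?g (w0 \<circ> u) * ?c u)) (T u) +
      scale (vv * (?g (w0 \<circ> (u \<circ> ?s)) * ?c (u \<circ> ?s))) (T (u \<circ> ?s)) =
      scale (f (w0 \<circ> u) * ?c u) (T u) * T ?s +
      scale (f (w0 \<circ> (u \<circ> ?s)) * ?c (u \<circ> ?s)) (T (u \<circ> ?s)) * T ?s"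
      unfolding comp_assoc[symmetric] 1 2 ..
  qed
  also have "\<dots> = (\<Sum>u\<in>symgrp r. scale (f (w0 \<circ> u) * ?c u) (T u) * T ?s)"
    by (rule sum_symgrp_pairs[OF i, symmetric])
  also have "\<dots> = orbit_map m w0 f * T ?s"
    by (simp add: orbit_map_def sum_distrib_right)
  finally show ?thesis .
qed

end

section \<open>The image of a weight space\<close>

text \<open>The letters of the first part are at most \<open>length xs\<close> and those of the
  second part exceed it. Preserving the whole word thus means preserving both segments and the word
  on each, the second after a shift of positions.\<close>

lemma young_append:
  assumes r: "sum_list xs + sum_list ys = r"
  shows "young r (xs @ ys) = {w \<in> symgrp r.
    (\<forall>k\<in>{1..sum_list xs}. w k \<in> {1..sum_list xs} \<and> sorted_word xs (w k) = sorted_word xs k) \<and>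
    (\<forall>k\<in>{sum_list xs<..r}. w k \<in> {sum_list xs<..r} \<and>
      sorted_word ys (w k - sum_list xs) = sorted_word ys (k - sum_list xs))}"
    (is "_ = {w \<in> symgrp r. ?P w}")
proof -
  let ?K = "sum_list xs" and ?s = "sorted_word (xs @ ys)"
  have s1: "?s k = sorted_word xs k" "sorted_word xs k \<in> {1..length xs}" if "k \<in> {1..?K}" for k
    using sorted_word_append[of k xs ys] sorted_word_range[of k xs] that by auto
  have s2: "?s k = length xs + sorted_word ys (k - ?K)" "sorted_word ys (k - ?K) \<in> {1..length ys}"
    if "k \<in> {?K<..r}" for k
  proof -
    have "k - ?K \<in> {1..sum_list ys}" using that r by auto
    then show "?s k = length xs + sorted_word ys (k - ?K)" "sorted_word ys (k - ?K) \<in> {1..length ys}"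
      using sorted_word_append[of k xs ys] sorted_word_range[of "k - ?K" ys] that r by auto
  qed
  have split: "k \<in> {1..r} \<longleftrightarrow> k \<in> {1..?K} \<or> k \<in> {?K<..r}" for k
    using r by auto
  have "(\<forall>k\<in>{1..r}. ?s (w k) = ?s k) \<longleftrightarrow> ?P w" if w: "w \<in> symgrp r" for w
  proof
    assume eq: "\<forall>k\<in>{1..r}. ?s (w k) = ?s k"
    have mem: "w k \<in> {1..r}" if "k \<in> {1..r}" for k using symgrp_mem[OF w] that by blast
    have "w k \<in> {1..?K} \<and> sorted_word xs (w k) = sorted_word xs k" if k: "k \<in> {1..?K}" for k
    proof -
      have kr: "k \<in> {1..r}" using k split by blast
      have "?s (w k) = sorted_word xs k" using eq kr s1(1)[OF k] by auto
      then show ?thesis using s1[OF k] s2[of "w k"] s1[of "w k"] mem[OF kr] split[of "w k"] by fastforce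
    qed
    moreover have "w k \<in> {?K<..r} \<and> sorted_word ys (w k - ?K) = sorted_word ys (k - ?K)"
      if k: "k \<in> {?K<..r}" for k
    proof -
      have kr: "k \<in> {1..r}" using k split by blast
      have "?s (w k) = length xs + sorted_word ys (k - ?K)" using eq kr s2(1)[OF k] by auto
      then show ?thesis using s2[OF k] s2[of "w k"] s1[of "w k"] mem[OF kr] split[of "w k"] by fastforce
    qed
    ultimately show "?P w" by blast
  next
    assume P: "?P w"
    show "\<forall>k\<in>{1..r}. ?s (w k) = ?s k"
    proof
      fix k assume "k \<in> {1..r}"
      then consider "k \<in> {1..?K}" | "k \<in> {?K<..r}" using split by blast
      then show "?s (w k) = ?s k"
        using P by cases (metis s1(1), metis s2(1))
    qed
  qed
  then show ?thesis
    using young_eq_stabilizer[of "xs @ ys" r] r by auto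
qed

section \<open>Factorisation of the Young subgroup of a pair of compositions\<close>

lemma symgrp_fix: "w \<in> symgrp r \<Longrightarrow> k \<notin> {1..r} \<Longrightarrow> w k = k"
  unfolding symgrp_def mem_Collect_eq by (rule permutes_not_in)

lemma symgrpI:
  assumes "inj_on f {1..r}" "f ` {1..r} \<subseteq> {1..r}" "\<And>k. k \<notin> {1..r} \<Longrightarrow> f k = k"
  shows "f \<in> symgrp r"
proof -
  have "f ` {1..r} = {1..r}" by (rule endo_inj_surj) (use assms in auto)
  then have "bij_betw f {1..r} {1..r}" using assms(1) by (simp add: bij_betw_def)
  then show ?thesis unfolding symgrp_def using bij_imp_permutes assms(3) by blast
qed

text \<open>On the segment padded by parts of size one the sorted word is injective, so its points
  are fixed.\<close>

lemma young_upper_star: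
  assumes p: "(lam, mu) \<in> Lam m n r"
  shows "young r (upper_star r lam) = {w \<in> young r (lam @ mu). \<forall>k\<in>{sum_list lam<..r}. w k = k}"
proof -
  let ?K = "sum_list lam" and ?ones = "replicate (r - sum_list lam) (1 :: nat)"
  have r: "?K + sum_list mu = r" "?K + sum_list ?ones = r" using p by (simp_all add: Lam_def sum_list_replicate)
  have eq: "sorted_word ?ones (k - ?K) = k - ?K" if "k \<in> {?K<..r}" for k
    by (rule sorted_word_replicate) (use that in auto)
  have "(\<forall>k\<in>{?K<..r}. w k \<in> {?K<..r} \<and> sorted_word ?ones (w k - ?K) = sorted_word ?ones (k - ?K))
    \<longleftrightarrow> (\<forall>k\<in>{?K<..r}. w k = k)" for w
  proof (intro ball_cong refl iffI)
    fix k assume k: "k \<in> {?K<..r}"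
      and w: "w k \<in> {?K<..r} \<and> sorted_word ?ones (w k - ?K) = sorted_word ?ones (k - ?K)"
    then have "w k - ?K = k - ?K" using eq[of k] eq[of "w k"] by metis
    then show "w k = k" using k w by auto
  qed simp
  then show ?thesis
    unfolding upper_star_def young_append[OF r(1)] young_append[OF r(2)] by auto
qed

lemma young_lower_star:
  assumes p: "(lam, mu) \<in> Lam m n r"
  shows "young r (lower_star r mu) = {w \<in> young r (lam @ mu). \<forall>k\<in>{1..sum_list lam}. w k = k}"
proof -
  let ?K = "sum_list lam" and ?ones = "replicate (sum_list lam) (1 :: nat)"
  have r: "?K + sum_list mu = r" "sum_list ?ones + sum_list mu = r" and K: "sum_list ?ones = ?K"
    using p by (simp_all add: Lam_def sum_list_replicate)
  have "(\<forall>k\<in>{1..?K}. w k \<in> {1..?K} \<and> sorted_word ?ones (w k) = sorted_word ?ones k)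
    \<longleftrightarrow> (\<forall>k\<in>{1..?K}. w k = k)" for w
  proof (intro ball_cong refl iffI)
    fix k assume "k \<in> {1..?K}" "w k \<in> {1..?K} \<and> sorted_word ?ones (w k) = sorted_word ?ones k"
    then show "w k = k" using sorted_word_replicate[of k ?K] sorted_word_replicate[of "w k" ?K] by metis
  qed simp
  \<comment> \<open>This is the number of ones that pad \<open>mu\<close> on the left.\<close>
  moreover have "r - sum_list mu = ?K" using r by simp
  ultimately show ?thesis
    unfolding lower_star_def using young_append[OF r(1)] young_append[OF r(2)] unfolding K by auto
qed

text \<open>An element of the full Young subgroup preserves both segments, so it splits into its
  restrictions, each extended by the identity. The two factors move disjoint sets of points.\<close>

lemma young_comp_bij:
  assumes p: "(lam, mu) \<in> Lam m n r"
  shows "bij_betw (\<lambda>(a, b). a \<circ> b)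
    (young r (upper_star r lam) \<times> young r (lower_star r mu)) (young r (lam @ mu))"
proof -
  let ?K = "sum_list lam" and ?Y = "young r (lam @ mu)"
  let ?U = "young r (upper_star r lam)" and ?L = "young r (lower_star r mu)"
  have r: "?K + sum_list mu = r" using p by (simp add: Lam_def)
  have sym: "w \<in> symgrp r" if "w \<in> ?Y" for w using that by (simp add: young_def)
  have low: "w k \<in> {1..?K}" if "w \<in> ?Y" "k \<in> {1..?K}" for w k
    using that unfolding young_append[OF r] by blast
  have high: "w k \<in> {?K<..r}" if "w \<in> ?Y" "k \<in> {?K<..r}" for w k
    using that unfolding young_append[OF r] by blast
  have out: "w k = k" if "w \<in> ?Y" "k \<notin> {1..r}" for w k
    using symgrp_fix[OF sym] that by blast
  let ?A = "\<lambda>u k. if k \<in> {1..?K} then u k else k" and ?B = "\<lambda>u k. if k \<in> {1..?K} then k else u k"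
  have A: "?A u \<in> ?U" and B: "?B u \<in> ?L" if u: "u \<in> ?Y" for u
  proof -
    have inj: "u k = u l \<longleftrightarrow> k = l" for k l using symgrp_inj[OF sym[OF u]] .
    have hi: "u k \<notin> {1..?K}" if "k \<notin> {1..?K}" for k
      using high[OF u, of k] out[OF u, of k] that by (cases "k \<in> {1..r}") auto
    have "?A u \<in> symgrp r"
    proof (rule symgrpI)
      show "inj_on (?A u) {1..r}" using low[OF u] inj by (auto simp: inj_on_def)
      show "?A u ` {1..r} \<subseteq> {1..r}"
        by (rule image_subsetI) (simp only: symgrp_mem[OF sym[OF u]] split: if_split, blast)
    qed (use out[OF u] in auto)
    moreover have "?B u \<in> symgrp r"
    proof (rule symgrpI)
      show "inj_on (?B u) {1..r}" using hi inj by (auto simp: inj_on_def)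
      show "?B u ` {1..r} \<subseteq> {1..r}"
        by (rule image_subsetI) (simp only: symgrp_mem[OF sym[OF u]] split: if_split, blast)
    qed (use out[OF u] r in auto)
    ultimately show "?A u \<in> ?U" "?B u \<in> ?L"
      using u unfolding young_upper_star[OF p] young_lower_star[OF p] young_append[OF r] by auto
  qed
  have U: "a \<in> ?Y" "\<And>k. k \<notin> {1..?K} \<Longrightarrow> a k = k" if "a \<in> ?U" for a
    using that out[of a] unfolding young_upper_star[OF p] by (auto simp: not_le)
  have L: "b \<in> ?Y" "\<And>k. k \<in> {1..?K} \<Longrightarrow> b k = k" if "b \<in> ?L" for b
    using that unfolding young_lower_star[OF p] by auto
  have hi: "b k \<notin> {1..?K}" if "b \<in> ?L" "k \<notin> {1..?K}" for b k
    using high[OF L(1)[OF that(1)], of k] out[OF L(1)[OF that(1)], of k] that(2)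
    by (cases "k \<in> {1..r}") auto
  have ab: "(a \<circ> b) k = (if k \<in> {1..?K} then a k else b k)" if "a \<in> ?U" "b \<in> ?L" for a b k
    using U(2)[OF that(1)] L(2)[OF that(2)] hi[OF that(2)] by simp
  show ?thesis
  proof (rule bij_betw_byWitness[where f' = "\<lambda>u. (?A u, ?B u)"])
    show "\<forall>x\<in>?U \<times> ?L. (\<lambda>u. (?A u, ?B u)) ((\<lambda>(a, b). a \<circ> b) x) = x"
    proof
      fix x assume "x \<in> ?U \<times> ?L"
      then obtain a b where x: "x = (a, b)" and a: "a \<in> ?U" and b: "b \<in> ?L" by blast
      have "?A (a \<circ> b) k = a k" "?B (a \<circ> b) k = b k" for k
        using ab[OF a b, of k] U(2)[OF a, of k] L(2)[OF b, of k] by presburger+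
      then show "(\<lambda>u. (?A u, ?B u)) ((\<lambda>(a, b). a \<circ> b) x) = x"
        unfolding x prod.case by blast
    qed
    show "\<forall>u\<in>?Y. (\<lambda>(a, b). a \<circ> b) ((\<lambda>u. (?A u, ?B u)) u) = u"
      using ab[OF A B] by (auto simp: fun_eq_iff)
    show "(\<lambda>(a, b). a \<circ> b) ` (?U \<times> ?L) \<subseteq> ?Y"
    proof clarify
      fix a b assume "a \<in> ?U" "b \<in> ?L"
      then have "a \<in> ?Y" "b \<in> ?Y" using U(1) L(1) by auto
      then show "a \<circ> b \<in> ?Y"
        by (simp add: young_def symgrp_comp image_comp[symmetric] del: comp_apply)
    qed
    show "(\<lambda>u. (?A u, ?B u)) ` ?Y \<subseteq> ?U \<times> ?L" using A B by auto
  qed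
qed

text \<open>Each factor preserves both segments and fixes one of them pointwise. No inversion joins
  the two segments, and on each segment the product agrees with the factor that may move it.\<close>

lemma invs_comp_young:
  assumes p: "(lam, mu) \<in> Lam m n r"
    and a: "a \<in> young r (upper_star r lam)" and b: "b \<in> young r (lower_star r mu)"
  shows "invs r (a \<circ> b) = invs r a \<union> invs r b" "invs r a \<subseteq> {1..sum_list lam} \<times> {1..sum_list lam}"
    "invs r b \<subseteq> {sum_list lam<..r} \<times> {sum_list lam<..r}"
proof -
  let ?K = "sum_list lam"
  have r: "?K + sum_list mu = r" using p by (simp add: Lam_def)
  have A: "a k \<in> {1..?K}" if "k \<in> {1..?K}" for k
    using a that unfolding young_upper_star[OF p] young_append[OF r] by blast
  have A': "a k = k" if "k \<in> {?K<..r}" for k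
    using a that unfolding young_upper_star[OF p] by blast
  have B: "b k \<in> {?K<..r}" if "k \<in> {?K<..r}" for k
    using b that unfolding young_lower_star[OF p] young_append[OF r] by blast
  have B': "b k = k" if "k \<in> {1..?K}" for k
    using b that unfolding young_lower_star[OF p] by blast
  have split: "k \<in> {1..r} \<longleftrightarrow> k \<in> {1..?K} \<or> k \<in> {?K<..r}" for k
    using r by auto
  have ab: "(a \<circ> b) k = (if k \<le> ?K then a k else b k)" if "k \<in> {1..r}" for k
    using that A' B B' split[of k] by auto
  show "invs r a \<subseteq> {1..?K} \<times> {1..?K}"
  proof clarify
    fix k l assume "(k, l) \<in> invs r a"
    then have kl: "k \<in> {1..r}" "l \<in> {1..r}" "k < l" "a l < a k" by (auto simp: invs_def)
    have "l \<le> ?K"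
    proof (rule ccontr)
      assume "\<not> l \<le> ?K"
      then show False using kl A[of k] A'[of k] A'[of l] by (cases "k \<le> ?K") auto
    qed
    then show "k \<in> {1..?K} \<and> l \<in> {1..?K}" using kl by auto
  qed
  show "invs r b \<subseteq> {?K<..r} \<times> {?K<..r}"
  proof clarify
    fix k l assume "(k, l) \<in> invs r b"
    then have kl: "k \<in> {1..r}" "l \<in> {1..r}" "k < l" "b l < b k" by (auto simp: invs_def)
    have "\<not> k \<le> ?K"
    proof
      assume "k \<le> ?K"
      then show False using kl B[of l] B'[of k] B'[of l] by (cases "l \<le> ?K") auto
    qed
    then show "k \<in> {?K<..r} \<and> l \<in> {?K<..r}" using kl by auto
  qed
  have "(k, l) \<in> invs r (a \<circ> b) \<longleftrightarrow> (k, l) \<in> invs r a \<or> (k, l) \<in> invs r b" for k l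
  proof (cases "k \<in> {1..r} \<and> l \<in> {1..r} \<and> k < l")
    case True
    then consider "l \<le> ?K" "k \<le> ?K" | "\<not> l \<le> ?K" "k \<le> ?K" | "\<not> l \<le> ?K" "\<not> k \<le> ?K" by linarith
    then show ?thesis
    proof cases
      case 1
      then show ?thesis using True ab[of k] ab[of l] B'[of k] B'[of l] by (auto simp: invs_def)
    next
      case 2
      then show ?thesis using True ab[of k] ab[of l] A[of k] A'[of l] B'[of k] B[of l] by (auto simp: invs_def)
    next
      case 3
      then show ?thesis using True ab[of k] ab[of l] A'[of k] A'[of l] by (auto simp: invs_def)
    qed
  qed (auto simp: invs_def)
  then show "invs r (a \<circ> b) = invs r a \<union> invs r b" by auto
qed

text \<open>Along an inversion the sorted word weakly increases in position and weakly decreases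
  after the permutation, which leaves it unchanged; so the two letters agree. Even letters then give
  the factor 1 and odd letters \<open>- qinv\<close>. Lengths add because the inversion sets are
  disjoint.\<close>

lemma inv_coeff_young:
  assumes p: "(lam, mu) \<in> Lam m n r"
    and a: "a \<in> young r (upper_star r lam)" and b: "b \<in> young r (lower_star r mu)"
  shows "inv_coeff m r (sorted_word (lam @ mu)) (a \<circ> b) = (- qinv) ^ len r b"
    and "len r (a \<circ> b) = len r a + len r b"
proof -
  let ?K = "sum_list lam" and ?s = "sorted_word (lam @ mu)"
  note I = invs_comp_young[OF p a b]
  have r: "?K + sum_list mu = r" "length lam = m" using p by (simp_all add: Lam_def)
  have ab: "a \<circ> b \<in> young r (lam @ mu)"
    using young_comp_bij[OF p] a b by (auto simp: bij_betw_def)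
  have sym: "a \<in> symgrp r" "b \<in> symgrp r" using a b by (simp_all add: young_def)
  have disj: "invs r a \<inter> invs r b = {}" using I(2,3) by fastforce
  show "len r (a \<circ> b) = len r a + len r b"
    using I(1) disj by (simp add: len_eq_card_invs sym symgrp_comp card_Un_disjoint)
  have s: "?s ((a \<circ> b) k) = ?s k" if "k \<in> {1..r}" for k
    using ab that young_eq_stabilizer[of "lam @ mu" r] r by auto
  have eq: "?s k = ?s l" if kl: "(k, l) \<in> invs r (a \<circ> b)" for k l
  proof -
    have m: "k \<in> {1..r}" "l \<in> {1..r}" "k \<le> l" "(a \<circ> b) l \<le> (a \<circ> b) k"
      using kl by (auto simp: invs_def)
    have "(a \<circ> b) k \<in> {1..r}" "(a \<circ> b) l \<in> {1..r}"
      using symgrp_mem[OF symgrp_comp[OF sym]] m by blast+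
    then show ?thesis
      using sorted_word_mono[of k "lam @ mu" l] sorted_word_mono[of "(a \<circ> b) l" "lam @ mu" "(a \<circ> b) k"]
        s[of k] s[of l] m r by simp
  qed
  have chi: "chi m (?s ((a \<circ> b) k)) (?s ((a \<circ> b) l)) = (if ?s k \<le> m then 1 else - qinv)"
    if "(k, l) \<in> invs r (a \<circ> b)" for k l
    using eq[OF that] s[of k] s[of l] that by (simp add: chi_def invs_def)
  have le: "?s k \<le> m" if "k \<in> {1..?K}" for k
    using sorted_word_append[of k lam mu] sorted_word_range[of k lam] that r by auto
  have gt: "\<not> ?s k \<le> m" if "k \<in> {?K<..r}" for k
  proof -
    have "k - ?K \<in> {1..sum_list mu}" using that r by auto
    then show ?thesis
      using sorted_word_append[of k lam mu] sorted_word_range[of "k - ?K" mu] that r by auto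
  qed
  have "inv_coeff m r ?s (a \<circ> b) = (\<Prod>(k, l)\<in>invs r (a \<circ> b). if ?s k \<le> m then 1 else - qinv)"
    unfolding inv_coeff_def by (rule prod.cong) (use chi in auto)
  also have "\<dots> = (\<Prod>(k, l)\<in>invs r a. if ?s k \<le> m then 1 else - qinv) *
      (\<Prod>(k, l)\<in>invs r b. if ?s k \<le> m then 1 else - qinv)"
    unfolding I(1) by (rule prod.union_disjoint) (simp_all add: disj)
  also have "(\<Prod>(k, l)\<in>invs r a. if ?s k \<le> m then 1 else - qinv) = (1 :: laurent)"
    by (rule prod.neutral) (use I(2) le in force)
  also have "(\<Prod>(k, l)\<in>invs r b. if ?s k \<le> m then 1 else - qinv) = (\<Prod>_\<in>invs r b. - qinv)"
    by (rule prod.cong) (use I(3) gt in auto)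
  finally show "inv_coeff m r ?s (a \<circ> b) = (- qinv) ^ len r b"
    unfolding len_eq_card_invs[OF sym(2)] by (simp only: prod_constant mult_1)
qed

context hecke_algebra
begin

lemma scale_scale_vinv: "scale vinv (scale vv x) = x"
  by simp

text \<open>Only the stabilizer of the sorted word contributes, which is the full Young subgroup.
  Its factorisation is length-additive, so the sum becomes a product of two sums.\<close>

lemma orbit_map_ebasis_sorted_word:
  assumes p: "(lam, mu) \<in> Lam m n r"
  shows "orbit_map m (sorted_word (lam @ mu)) (ebasis (sorted_word (lam @ mu))) =
    x_elt r T lam * y_elt scale r T mu"
proof -
  let ?s = "sorted_word (lam @ mu)" and ?U = "young r (upper_star r lam)" and ?L = "young r (lower_star r mu)"
  have r: "sum_list (lam @ mu) = r" using p by (simp add: Lam_def)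
  have stab: "young r (lam @ mu) = {u \<in> symgrp r. ?s \<circ> u = ?s}"
  proof -
    have "(\<forall>k\<in>{1..r}. ?s (u k) = ?s k) \<longleftrightarrow> ?s \<circ> u = ?s" if u: "u \<in> symgrp r" for u
    proof
      assume eq: "\<forall>k\<in>{1..r}. ?s (u k) = ?s k"
      have "?s (u k) = ?s k" for k
        using eq symgrp_fix[OF u, of k] by (cases "k \<in> {1..r}") auto
      then show "?s \<circ> u = ?s" by (simp add: fun_eq_iff)
    qed (auto simp: fun_eq_iff)
    then show ?thesis using young_eq_stabilizer[OF r] by auto
  qed
  have "orbit_map m ?s (ebasis ?s) = (\<Sum>u\<in>symgrp r. if ?s \<circ> u = ?s then scale (inv_coeff m r ?s u) (T u) else 0)"
    unfolding orbit_map_def ebasis_def by (rule sum.cong) auto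
  also have "\<dots> = (\<Sum>u\<in>young r (lam @ mu). scale (inv_coeff m r ?s u) (T u))"
    unfolding stab by (rule sum.inter_filter[symmetric]) simp
  also have "\<dots> = (\<Sum>x\<in>?U \<times> ?L. scale (inv_coeff m r ?s (case x of (a, b) \<Rightarrow> a \<circ> b)) (T (case x of (a, b) \<Rightarrow> a \<circ> b)))"
    by (rule sum.reindex_bij_betw[OF young_comp_bij[OF p], symmetric])
  also have "\<dots> = (\<Sum>(a, b)\<in>?U \<times> ?L. T a * scale ((- qinv) ^ len r b) (T b))"
  proof (rule sum.cong[OF refl], clarify)
    fix a b assume a: "a \<in> ?U" and b: "b \<in> ?L"
    have "a \<in> symgrp r" "b \<in> symgrp r" using a b by (simp_all add: young_def)
    then have "T a * T b = T (a \<circ> b)" using inv_coeff_young(2)[OF p a b] by (rule T_mult)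
    then show "scale (inv_coeff m r ?s (a \<circ> b)) (T (a \<circ> b)) = T a * scale ((- qinv) ^ len r b) (T b)"
      unfolding inv_coeff_young(1)[OF p a b] scale_mult_right[symmetric] by simp
  qed
  also have "\<dots> = x_elt r T lam * y_elt scale r T mu"
    by (simp add: x_elt_def y_elt_def sum_product sum.cartesian_product)
  finally show ?thesis .
qed

lemma xyH_zero: "0 \<in> xyH scale r T p"
  unfolding xyH_def by (force intro: exI[of _ 0])

lemma xyH_add: "x \<in> xyH scale r T p \<Longrightarrow> y \<in> xyH scale r T p \<Longrightarrow> x + y \<in> xyH scale r T p"
  unfolding xyH_def by (force simp: distrib_left[symmetric])

lemma xyH_scale: "x \<in> xyH scale r T p \<Longrightarrow> scale c x \<in> xyH scale r T p"
  unfolding xyH_def by (force simp: scale_mult_right)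

lemma xyH_diff: "x \<in> xyH scale r T p \<Longrightarrow> y \<in> xyH scale r T p \<Longrightarrow> x - y \<in> xyH scale r T p"
  unfolding xyH_def by (force simp: right_diff_distrib[symmetric])

lemma xyH_mult: "x \<in> xyH scale r T p \<Longrightarrow> x * h \<in> xyH scale r T p"
  unfolding xyH_def by (force simp: mult.assoc)

lemma xyH_sum: "(\<And>x. x \<in> A \<Longrightarrow> F x \<in> xyH scale r T p) \<Longrightarrow> (\<Sum>x\<in>A. F x) \<in> xyH scale r T p"
  by (induction A rule: infinite_finite_induct) (simp_all add: xyH_zero xyH_add)

abbreviation part_map :: "nat \<Rightarrow> nat list \<times> nat list \<Rightarrow> ((nat \<Rightarrow> nat) \<Rightarrow> laurent) \<Rightarrow> 'h" where
  "part_map m p \<equiv> orbit_map m (sorted_word (fst p @ snd p))"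

lemma part_map_R_op:
  assumes "p \<in> Lam m n r" "i \<in> {1..<r}"
  shows "scale vv (part_map m p (R_op m n r i f)) = part_map m p f * T (simple_refl i)"
proof (rule orbit_map_R_op)
  show "sorted_word (fst p @ snd p) \<in> words m n r"
    using assms(1) sorted_word_words by (metis prod.collapse)
  show "sorted_word (fst p @ snd p) k \<le> sorted_word (fst p @ snd p) l"
    if "k \<in> {1..r}" "l \<in> {1..r}" "k \<le> l" for k l
    using that assms(1) by (intro sorted_word_mono) (auto simp: Lam_def)
qed (rule assms)

text \<open>\<open>act_T\<close> and \<open>T_reduced\<close> follow the same reduced word, so the
  intertwining relation is applied letter by letter; expanding \<open>h\<close> in the basis gives
  the general case.\<close>

lemma part_map_tensor_act:
  assumes p: "p \<in> Lam m n r"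
  shows "part_map m p (tensor_act m n scale r T f h) = part_map m p f * h"
proof -
  let ?g = "\<lambda>is. foldl (\<lambda>g i. R_op m n r i g) f is"
  \<comment> \<open>Each letter costs one factor \<open>vv\<close>, since R corresponds to the
    rescaled generator; \<open>act_T\<close> supplies exactly this power.\<close>
  have word: "scale (vv ^ length is) (part_map m p (?g is)) =
      part_map m p f * foldl (\<lambda>x i. x * T (simple_refl i)) 1 is" if "set is \<subseteq> {1..<r}" for "is"
    using that
  proof (induction "is" rule: rev_induct)
    case (snoc i "is")
    have "scale (vv ^ length (is @ [i])) (part_map m p (?g (is @ [i]))) =
        scale (vv ^ length is) (scale vv (part_map m p (R_op m n r i (?g is))))"
      by (simp add: mult.commute)
    also have "\<dots> = scale (vv ^ length is) (part_map m p (?g is)) * T (simple_refl i)"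
      using snoc.prems by (subst part_map_R_op[OF p]) (simp_all add: scale_mult_left)
    finally show ?case using snoc by (simp add: mult.assoc)
  qed simp
  have act: "part_map m p (act_T m n r f u) = part_map m p f * T u" if "u \<in> symgrp r" for u
    using word[of "reduced_word r u"] reduced_word[OF that] T_reduced[OF that]
    by (simp add: act_T_def orbit_map_lscale)
  have "part_map m p (tensor_act m n scale r T f h) =
      (\<Sum>u\<in>symgrp r. scale (representation (T ` symgrp r) h (T u)) (part_map m p (act_T m n r f u)))"
    unfolding tensor_act_def orbit_map_sum orbit_map_lscale ..
  also have "\<dots> = part_map m p f * (\<Sum>u\<in>symgrp r. scale (representation (T ` symgrp r) h (T u)) (T u))"
    by (simp add: act sum_distrib_left scale_mult_right)
  finally show ?thesis using T_expansion[of h] by simp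
qed

text \<open>For distinct letters R sends the basis vector at \<open>w\<close> to a sign times the
  one at the swapped word plus a multiple of itself. Solving for the swapped vector keeps its image
  in the right ideal.\<close>

lemma part_map_ebasis_xyH:
  assumes p: "p \<in> Lam m n r" and u: "u \<in> symgrp r"
  shows "part_map m p (ebasis (sorted_word (fst p @ snd p) \<circ> u)) \<in> xyH scale r T p"
proof -
  let ?s = "sorted_word (fst p @ snd p)"
  have sw: "?s \<in> words m n r" using p sorted_word_words by (metis prod.collapse)
  have "part_map m p (ebasis (?s \<circ> word_perm is)) \<in> xyH scale r T p" if "set is \<subseteq> {1..<r}" for "is"
    using that
  proof (induction "is" rule: rev_induct)
    case Nil
    have "part_map m p (ebasis ?s) = x_elt r T (fst p) * y_elt scale r T (snd p) * 1"
      using orbit_map_ebasis_sorted_word[of "fst p" "snd p" m n] p by simp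
    then have "part_map m p (ebasis ?s) \<in> xyH scale r T p" unfolding xyH_def by blast
    then show ?case by (simp only: word_perm_Nil comp_id)
  next
    case (snoc i "is")
    define w where "w = ?s \<circ> word_perm is"
    let ?E = "\<lambda>w. part_map m p (ebasis w)"
    have i: "i \<in> {1..<r}" using snoc.prems by simp
    have E: "?E w \<in> xyH scale r T p"
      unfolding w_def by (rule snoc.IH) (use snoc.prems in simp)
    have w: "w \<in> words m n r" unfolding w_def
      using snoc.prems by (intro words_comp_symgrp sw word_perm_symgrp) simp
    have "?E (w \<circ> simple_refl i) \<in> xyH scale r T p"
    proof (cases "w i = w (Suc i)")
      case True
      then have "w \<circ> simple_refl i = w" by (auto simp: fun_eq_iff simple_refl_def transpose_def)
      then show ?thesis using E by simp
    next
      case False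
      define e where "e = bsign (hat m (w i) * hat m (w (Suc i))) (1 :: laurent)"
      have "R_op m n r i (ebasis w) = lscale e (ebasis (w \<circ> simple_refl i)) +
          lscale (diag_coeff m (w i) (w (Suc i))) (ebasis w)"
      proof -
        have "R_op m n r i (ebasis w) = (\<Sum>w'\<in>words m n r. if w' = w then R_basis m i w else 0)"
          unfolding R_op_def by (rule sum.cong) (auto simp: ebasis_def lscale_def)
        then have "R_op m n r i (ebasis w) = R_basis m i w" using w by (simp only: sum.delta finite_words if_True)
        then show ?thesis using False
          by (auto simp: R_basis_def Let_def diag_coeff_def e_def bsign_def lscale_def fun_eq_iff)
      qed
      then have "scale vv (scale e (?E (w \<circ> simple_refl i)) + scale (diag_coeff m (w i) (w (Suc i))) (?E w)) =
          ?E w * T (simple_refl i)"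
        using part_map_R_op[OF p i, of "ebasis w"] by (simp only: orbit_map_add orbit_map_lscale)
      then have "scale e (?E (w \<circ> simple_refl i)) =
          scale vinv (?E w * T (simple_refl i)) - scale (diag_coeff m (w i) (w (Suc i))) (?E w)"
        by (metis scale_scale_vinv add_diff_cancel_right')
      also have "\<dots> \<in> xyH scale r T p" by (intro xyH_diff xyH_scale xyH_mult E)
      \<comment> \<open>The sign is its own inverse, so a second multiplication removes it.\<close>
      finally have "scale e (scale e (?E (w \<circ> simple_refl i))) \<in> xyH scale r T p" by (rule xyH_scale)
      moreover have "e * e = 1" by (simp add: e_def bsign_def)
      ultimately show ?thesis by simp
    qed
    then show ?case by (simp only: w_def word_perm_snoc comp_assoc)
  qed
  from this[of "reduced_word r u"] show ?thesis using reduced_word[OF u] by simp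
qed

text \<open>Only the values of \<open>f\<close> on the rearrangements of the sorted word matter, so
  \<open>f\<close> can be replaced by its finite expansion over these basis vectors.\<close>

lemma part_map_xyH:
  assumes p: "p \<in> Lam m n r"
  shows "part_map m p f \<in> xyH scale r T p"
proof -
  let ?s = "sorted_word (fst p @ snd p)"
  define W where "W = (\<lambda>u. ?s \<circ> u) ` symgrp r"
  have "part_map m p f = part_map m p (\<Sum>w\<in>W. lscale (f w) (ebasis w))"
  proof -
    have sum_apply: "(\<Sum>x\<in>A. F x) w = (\<Sum>x\<in>A. F x w)" for A w and F :: "(nat \<Rightarrow> nat) \<Rightarrow> (nat \<Rightarrow> nat) \<Rightarrow> laurent"
      by (induction A rule: infinite_finite_induct) simp_all
    have "(\<Sum>w\<in>W. lscale (f w) (ebasis w)) (?s \<circ> u) = f (?s \<circ> u)" if "u \<in> symgrp r" for u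
    proof -
      have "?s \<circ> u \<in> W" "finite W" using that by (auto simp: W_def)
      then show ?thesis unfolding sum_apply by (simp add: lscale_def ebasis_def if_distrib sum.delta' cong: if_cong)
    qed
    then show ?thesis unfolding orbit_map_def by (intro sum.cong) simp_all
  qed
  also have "\<dots> \<in> xyH scale r T p"
    unfolding orbit_map_sum orbit_map_lscale
    using part_map_ebasis_xyH[OF p] by (intro xyH_sum xyH_scale) (auto simp: W_def)
  finally show ?thesis .
qed

text \<open>The generator of the right ideal is the image of the sorted basis vector, and the tensor
  action reaches all its multiples.\<close>

lemma part_map_surj:
  assumes p: "p \<in> Lam m n r" and z: "z \<in> xyH scale r T p"
  shows "\<exists>f\<in>tensor_space m n r. part_map m p f = z"
proof -
  let ?s = "sorted_word (fst p @ snd p)"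
  obtain h where h: "z = x_elt r T (fst p) * y_elt scale r T (snd p) * h" using z by (auto simp: xyH_def)
  have "?s \<in> words m n r" using p sorted_word_words by (metis prod.collapse)
  then have "ebasis ?s \<in> tensor_space m n r" by (auto simp: tensor_space_def ebasis_def)
  moreover have "part_map m p (ebasis ?s) = x_elt r T (fst p) * y_elt scale r T (snd p)"
    using orbit_map_ebasis_sorted_word[of "fst p" "snd p" m n] p by simp
  ultimately show ?thesis
    by (intro bexI[of _ "tensor_act m n scale r T (ebasis ?s) h"])
       (simp_all add: part_map_tensor_act[OF p] tensor_act_tensor_space h)
qed

text \<open>Coefficients in the basis \<open>T u\<close> can be compared, and the nonzero factor
  \<open>inv_coeff\<close> cancels.\<close>

lemma part_map_inj:
  assumes "part_map m p f = part_map m p g" "u \<in> symgrp r"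
  shows "f (sorted_word (fst p @ snd p) \<circ> u) = g (sorted_word (fst p @ snd p) \<circ> u)"
  using T_coeff_eq[OF assms[unfolded orbit_map_def]] inv_coeff_nonzero by simp

section \<open>All weight spaces together\<close>

definition schur_map :: "nat \<Rightarrow> nat \<Rightarrow> ((nat \<Rightarrow> nat) \<Rightarrow> laurent) \<Rightarrow> nat list \<times> nat list \<Rightarrow> 'h" where
  "schur_map m n f = (\<lambda>p. if p \<in> Lam m n r then part_map m p f else 0)"

lemma schur_map_add: "schur_map m n (f + g) = schur_map m n f + schur_map m n g"
  unfolding schur_map_def orbit_map_add by (simp add: fun_eq_iff)

lemma schur_map_lscale: "schur_map m n (lscale c f) = (\<lambda>p. scale c (schur_map m n f p))"
  by (simp add: schur_map_def orbit_map_lscale fun_eq_iff)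

lemma schur_map_tensor_act:
  "schur_map m n (tensor_act m n scale r T f h) = (\<lambda>p. schur_map m n f p * h)"
  by (rule ext) (simp add: schur_map_def part_map_tensor_act)

text \<open>Each word lies in the orbit of exactly one sorted word, that of its content. Hence the
  summands determine disjoint sets of coordinates, which together exhaust the tensor space.\<close>

lemma schur_map_bij: "bij_betw (schur_map m n) (tensor_space m n r) (schur_module m n scale r T)"
proof (rule bij_betw_imageI)
  show "inj_on (schur_map m n) (tensor_space m n r)"
  proof (rule inj_onI, rule ext)
    fix f g w assume f: "f \<in> tensor_space m n r" and g: "g \<in> tensor_space m n r"
      and eq: "schur_map m n f = schur_map m n g"
    show "f w = g w"
    proof (cases "w \<in> words m n r")
      case True
      obtain u where u: "u \<in> symgrp r"
        "w = sorted_word (fst (content m n r w) @ snd (content m n r w)) \<circ> u"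
        using word_eq_sorted_word_comp[OF True] .
      have "part_map m (content m n r w) f = part_map m (content m n r w) g"
        using fun_cong[OF eq, of "content m n r w"] content_Lam[OF True] by (simp add: schur_map_def)
      from part_map_inj[OF this u(1)] show ?thesis by (simp only: u(2)[symmetric])
    qed (use f g in \<open>simp add: tensor_space_def\<close>)
  qed
  show "schur_map m n ` tensor_space m n r = schur_module m n scale r T"
  proof (intro equalityI subsetI)
    fix y assume "y \<in> schur_map m n ` tensor_space m n r"
    then show "y \<in> schur_module m n scale r T"
      using part_map_xyH by (auto simp: schur_map_def schur_module_def)
  next
    fix y assume y: "y \<in> schur_module m n scale r T"
    have "\<forall>p\<in>Lam m n r. \<exists>f\<in>tensor_space m n r. part_map m p f = y p"
      using y part_map_surj by (auto simp: schur_module_def)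
    then obtain F where F: "\<And>p. p \<in> Lam m n r \<Longrightarrow> F p \<in> tensor_space m n r"
      "\<And>p. p \<in> Lam m n r \<Longrightarrow> part_map m p (F p) = y p" by metis
    \<comment> \<open>Glues the chosen preimages: at each word the one belonging to its own content
      is used.\<close>
    define f where "f = (\<lambda>w. if w \<in> words m n r then F (content m n r w) w else 0)"
    have "part_map m p f = y p" if p: "p \<in> Lam m n r" for p
    proof -
      have sw: "sorted_word (fst p @ snd p) \<in> words m n r" using p sorted_word_words by (metis prod.collapse)
      have "f (sorted_word (fst p @ snd p) \<circ> u) = F p (sorted_word (fst p @ snd p) \<circ> u)"
        if u: "u \<in> symgrp r" for u
        using words_comp_symgrp[OF sw u] content_sorted_word[of "fst p" "snd p" m n r u] p u
        by (simp add: f_def)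
      then have "part_map m p f = part_map m p (F p)"
        unfolding orbit_map_def by (intro sum.cong) simp_all
      then show ?thesis using F(2)[OF p] by simp
    qed
    then have "schur_map m n f = y"
      using y by (auto simp: schur_map_def schur_module_def fun_eq_iff)
    moreover have "f \<in> tensor_space m n r" by (simp add: f_def tensor_space_def)
    ultimately show "y \<in> schur_map m n ` tensor_space m n r" by blast
  qed
qed

text \<open>The parity counts letters above \<open>m\<close>; rearranging positions does not change
  their number, which is the sum of the second composition.\<close>

lemma tensor_par_sorted_word:
  assumes p: "p \<in> Lam m n r" and u: "u \<in> symgrp r"
  shows "tensor_par m r (sorted_word (fst p @ snd p) \<circ> u) = schur_par p"
proof -
  obtain lam mu where pq: "p = (lam, mu)" by (cases p)
  let ?K = "sum_list lam" and ?s = "sorted_word (lam @ mu)"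
  have r: "r = ?K + sum_list mu" "length lam = m" using p by (simp_all add: Lam_def pq)
  have s: "hat m (?s k) = (if k \<in> {?K<..r} then 1 else 0)" if k: "k \<in> {1..r}" for k
  proof (cases "k \<le> ?K")
    case True
    then show ?thesis
      using sorted_word_append[of k lam mu] sorted_word_range[of k lam] k r by (auto simp: hat_def)
  next
    case False
    then have "k - ?K \<in> {1..sum_list mu}" using k r by auto
    then show ?thesis
      using False sorted_word_append[of k lam mu] sorted_word_range[of "k - ?K" mu] k r by (auto simp: hat_def)
  qed
  have "tensor_par m r (?s \<circ> u) = (\<Sum>k\<in>{1..r}. hat m (?s (u k)))"
    by (simp add: tensor_par_def)
  also have "\<dots> = (\<Sum>k\<in>{1..r}. hat m (?s k))"
    by (rule sum.reindex_bij_betw) (use u in \<open>auto simp: symgrp_def intro: permutes_imp_bij\<close>)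
  also have "\<dots> = (\<Sum>k\<in>{1..r}. if k \<in> {?K<..r} then 1 else 0)"
    by (rule sum.cong) (simp_all only: s)
  also have "\<dots> = (\<Sum>k\<in>{?K<..r}. 1)"
    by (rule sum.mono_neutral_cong_right) auto
  also have "\<dots> = of_nat (sum_list mu)" by (simp add: r(1))
  finally show ?thesis by (simp add: schur_par_def pq)
qed

text \<open>All words of one content have the same parity, so a projection keeps or kills a whole
  summand.\<close>

lemma schur_map_gproj:
  "schur_map m n (gproj (tensor_par m r) b f) = gproj schur_par b (schur_map m n f)"
proof
  fix p
  show "schur_map m n (gproj (tensor_par m r) b f) p = gproj schur_par b (schur_map m n f) p"
  proof (cases "p \<in> Lam m n r")
    case True
    have "part_map m p (gproj (tensor_par m r) b f) =
        (\<Sum>u\<in>symgrp r. if schur_par p = b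
          then scale (f (sorted_word (fst p @ snd p) \<circ> u) * inv_coeff m r (sorted_word (fst p @ snd p)) u) (T u) else 0)"
      unfolding orbit_map_def gproj_def by (rule sum.cong) (simp_all add: tensor_par_sorted_word[OF True])
    then show ?thesis using True by (simp add: schur_map_def gproj_def orbit_map_def)
  qed (simp add: schur_map_def gproj_def)
qed

section \<open>The two graded modules and the isomorphism\<close>

lemma graded_module_schur:
  "graded_module (schur_module m n scale r T) schur_par scale (\<lambda>f h p. f p * h)"
proof
  show "f - g \<in> schur_module m n scale r T"
    if "f \<in> schur_module m n scale r T" "g \<in> schur_module m n scale r T" for f g
    using that by (auto simp: schur_module_def xyH_diff)
  show "gproj schur_par b f \<in> schur_module m n scale r T" if "f \<in> schur_module m n scale r T" for f b
    using that by (auto simp: schur_module_def gproj_def xyH_zero)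
  show "(\<lambda>p. f p * h) \<in> schur_module m n scale r T" if "f \<in> schur_module m n scale r T" for f h
    using that by (auto simp: schur_module_def xyH_mult)
qed (auto simp: schur_module_def xyH_zero gproj_def distrib_right scale_right_distrib fun_eq_iff)

lemma gproj_tensor_space: "f \<in> tensor_space m n r \<Longrightarrow> gproj par b f \<in> tensor_space m n r"
  by (simp add: tensor_space_def gproj_def)

text \<open>The tensor action is defined through chosen reduced words. Its additivity and its
  compatibility with the grading are read off after the injective map \<open>schur_map\<close>,
  where it is right multiplication.\<close>

lemma graded_module_tensor:
  "graded_module (tensor_space m n r) (tensor_par m r) (*) (tensor_act m n scale r T)"
proof
  let ?V = "tensor_space m n r" and ?act = "tensor_act m n scale r T"
  have inj: "x = y" if "schur_map m n x = schur_map m n y" "x \<in> ?V" "y \<in> ?V" for x y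
    using schur_map_bij[of m n] that by (meson bij_betw_imp_inj_on inj_onD)
  show "?act (f + g) h = ?act f h + ?act g h" if "f \<in> ?V" "g \<in> ?V" for f g h
  proof (rule inj)
    show "schur_map m n (?act (f + g) h) = schur_map m n (?act f h + ?act g h)"
      unfolding schur_map_tensor_act schur_map_add by (simp add: fun_eq_iff distrib_right)
  qed (intro add_tensor_space tensor_act_tensor_space that)+
  show "?act (gproj (tensor_par m r) b f) h = gproj (tensor_par m r) b (?act f h)" if "f \<in> ?V" for f b h
  proof (rule inj)
    show "schur_map m n (?act (gproj (tensor_par m r) b f) h) =
        schur_map m n (gproj (tensor_par m r) b (?act f h))"
      by (simp add: schur_map_tensor_act schur_map_gproj) (auto simp: gproj_def)
  qed (simp_all add: that tensor_act_tensor_space gproj_tensor_space)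
qed (simp_all add: zero_tensor_space diff_tensor_space gproj_tensor_space tensor_act_tensor_space distrib_left)

text \<open>The intermediate algebra has the Schur module and plain composition: the sign twist
  leads to it, and conjugation by \<open>schur_map\<close> leads on to the tensor side.\<close>

lemma schur_superalgebra_iso_tensor:
  "schur_superalgebra m n scale r T \<cong>\<^sub>s tensor_end_superalgebra m n scale r T"
proof (rule superalgebra_iso_trans)
  interpret schur: graded_module "schur_module m n scale r T" schur_par scale "\<lambda>f h p. f p * h"
    by (rule graded_module_schur)
  show "schur_superalgebra m n scale r T \<cong>\<^sub>s
      end_superalgebra (schur_module m n scale r T) schur_par scale (\<lambda>f h p. f p * h)"
    unfolding schur_superalgebra_def is_superalgebra_iso_def using schur.twist_superalgebra_iso by blast
  show "end_superalgebra (schur_module m n scale r T) schur_par scale (\<lambda>f h p. f p * h) \<cong>\<^sub>s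
      tensor_end_superalgebra m n scale r T"
    unfolding tensor_end_superalgebra_def
  proof (rule end_superalgebra_transport[OF graded_module_schur graded_module_tensor schur_map_bij])
    show "(\<lambda>w. c * f w) \<in> tensor_space m n r" if "f \<in> tensor_space m n r" for f c
      using lscale_tensor_space[OF that] by (simp add: lscale_def)
    show "schur_map m n (\<lambda>w. c * f w) = (\<lambda>p. scale c (schur_map m n f p))" for f c
      using schur_map_lscale by (simp add: lscale_def)
  qed (rule schur_map_add schur_map_tensor_act schur_map_gproj)+
qed

end

theorem corollary8p4:
  fixes m n r :: nat
    and scale :: "laurent \<Rightarrow> 'h::ring_1 \<Rightarrow> 'h"
    and T :: "(nat \<Rightarrow> nat) \<Rightarrow> 'h"
  assumes "m \<noteq> 0 \<or> n \<noteq> 0"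
    and "r \<ge> 1"
    and "hecke_algebra scale r T"
  shows "schur_superalgebra m n scale r T \<cong>\<^sub>s tensor_end_superalgebra m n scale r T"
  using assms(3) by (rule hecke_algebra.schur_superalgebra_iso_tensor)

end
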